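(* Let $E$ be a closed subset of $\mathbb{T}$, let $t\in E$, and let $\rho>0$. Assume that $f\not\equiv0$ is an analytic function in the lune $L_\tau(t)$, $0<\tau<1$, and that for some constant $C>0$ $$\log|f(z)|\le\frac{C}{d^{\rho}(z,E)},\qquad z\in L_\tau(t).$$ Then for any $\varepsilon>0$ there exists $\delta=\delta(\varepsilon,t,E)>0$, $\delta<\tau$, such that for the interior lune $L_\delta(t)$ $$\sum_{z\in Z(f)\cap L_\delta(t)}(1-|z|)\,d^{(\rho-\beta(t)+\varepsilon)_+}(z,E)<\infty .$$
   Context: $\mathbb{D}=\{|z|<1\}$, $\mathbb{T}=\{|t|=1\}$, $B(a,r)=\{z\in\mathbb{C}:|z-a|<r\}$. For $t\in\mathbb{T}$ and $\tau>0$ the lune is $L_\tau(t)=\mathbb{D}\cap B(t,\tau)$. $d(z,E)=\inf_{e\in E}|z-e|$ is the Euclidean distance, $d^{q}(z,E)=(d(z,E))^q$, and $a_+=\max(a,0)$. $Z(f)$ is the zero set of $f$ in its domain, each zero counted according to its multiplicity (sums over $Z(f)$ include multiplicities). Type of a closed set: for a nonempty closed set $E\subset\mathbb{T}$ and $x>0$ let $E_x=\{s\in\mathbb{T}:\hat d(s,E)<x\}$, where $\hat d(s_1,s_2)$ is the length of the shortest arc of $\mathbb{T}$ with endpoints $s_1,s_2$ and $\hat d(s,E)=\inf_{e\in E}\hat d(s,e)$. Let $|E_x|$ be the normalized Lebesgue measure of $E_x$ ($|\mathbb{T}|=1$). The type of $E$ is $$\beta(E)=\sup\{\beta\in\mathbb{R}:\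 |E_x|=O(x^{\beta}),\ x\to0\}.$$ One has $0\le\beta(E)\le1$, and $E_1\subset E_2$ implies $\beta(E_1)\ge\beta(E_2)$. Local type: for $t\in E$, the local type of $E$ at $t$ is $\beta(t)=\lim_{\delta\to0}\beta\bigl(E\cap\overline{B(t,\delta)}\bigr)$ (the limit exists by monotonicity). *)

theory Defs
  imports "HOL-Complex_Analysis.Complex_Analysis" "HOL-Library.Landau_Symbols"
begin

definition lune :: "complex \<Rightarrow> real \<Rightarrow> complex set" where
  "lune t r = ball 0 1 \<inter> ball t r"

(* Normalized Lebesgue measure on the unit circle, as the image of the uniform
   distribution of angles. *)
definition circle_measure :: "complex measure" where
  "circle_measure = distr (uniform_measure lborel {0..<2 * pi}) borel cis"

(* Length of the shortest arc of the unit circle joining s1 to s2: turning s1 by the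
   angle a sweeps out an arc of length \<bar>a\<bar>. Meaningful for s1, s2 on the circle. *)
definition arc_dist :: "complex \<Rightarrow> complex \<Rightarrow> real" where
  "arc_dist s1 s2 = Inf {\<bar>a\<bar> | a. s2 = s1 * cis a}"

(* The infimum over E is only meaningful for nonempty E. *)
definition arc_nbhd :: "complex set \<Rightarrow> real \<Rightarrow> complex set" where
  "arc_nbhd E x = {s \<in> sphere 0 1. (INF e\<in>E. arc_dist s e) < x}"

(* For nonempty E the set below contains 0 and is bounded above by 1, so the supremum
   of reals is the intended one. *)
definition set_type :: "complex set \<Rightarrow> real" where
  "set_type E =
     Sup {b. (\<lambda>x. measure circle_measure (arc_nbhd E x)) \<in> O[at_right 0](\<lambda>x. x powr b)}"

(* For t in E the function under the limit is bounded and monotone, so the limit exists. *)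
definition local_type :: "complex set \<Rightarrow> complex \<Rightarrow> real" where
  "local_type E t = Lim (at_right 0) (\<lambda>r. set_type (E \<inter> cball t r))"

end

theory Submission imports Defs begin

text \<open>
  Shrink \<open>t\<close>'s neighbourhood so that \<open>E\<close> has type \<open>b > \<beta>(t) - \<epsilon>\<close> there, and work in a lune
  \<open>G\<close> cut out of the disc by a circle orthogonal to it, which has explicit Blaschke factors.
  For a scale \<open>x\<close> consider \<open>\<Omega> = {w \<in> G. d(w,E) > \<eta> x}\<close>. On \<open>\<Omega>\<close> the growth bound is dominated by the
  real part of a sum of simple poles placed just outside the disc over dyadic nets of \<open>E\<close>; its value at a
  fixed point \<open>p\<close> is of order \<open>\<Sum> 2\<^sup>j\<^sup>(\<^sup>\<rho>\<^sup>-\<^sup>b\<^sup>)\<close> over \<open>2\<^sup>j \<lesssim> 1/x\<close>.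
  For a zero \<open>a\<close> with \<open>d(a,E) \<ge> x\<close>, the Blaschke factor of \<open>G\<close> times the exponential of a small
  pole term has modulus at least 1 on the boundary of \<open>\<Omega>\<close>, yet at most \<open>exp(-\<mu> (1-\<bar>a\<bar>))\<close> at \<open>p\<close>
  if \<open>\<eta>\<close> is small. Dividing out all these factors and applying the maximum principle bounds the sum of
  \<open>1-\<bar>a\<bar>\<close> over the zeros with \<open>d(a,E) \<ge> x\<close>; summation over dyadic \<open>x\<close> gives the theorem.
\<close>

subsection \<open>Maximum principle and division by zeros\<close>

text \<open>\<open>g\<close> need not extend to the frontier. The set where |V| < 1 - e has its
  closure inside \<open>\<Omega>\<close>, because |V| is at least 1 on the frontier of
  \<open>\<Omega>\<close>. On the frontier of that smaller set |g| is at most 1/(1 - e), so the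
  maximum modulus principle applies there; finally e tends to 0.\<close>

lemma modulus_le_1_by_boundary:
  fixes g V :: "complex \<Rightarrow> complex"
  assumes "open \<Omega>" "bounded \<Omega>" and holg: "g holomorphic_on \<Omega>"
    and contV: "continuous_on (closure \<Omega>) V"
    and V: "\<And>w. w \<in> frontier \<Omega> \<Longrightarrow> cmod (V w) \<ge> 1"
    and le: "\<And>w. w \<in> \<Omega> \<Longrightarrow> cmod (g w * V w) \<le> 1"
    and "p \<in> \<Omega>"
  shows "cmod (g p) \<le> 1"
proof -
  have bound: "cmod (g p) \<le> 1 / (1 - e)" if e: "0 < e" "e < 1" for e :: real
  proof (cases "cmod (V p) < 1 - e")
    case False
    then have "(1 - e) * cmod (g p) \<le> cmod (V p) * cmod (g p)"
      by (intro mult_right_mono) auto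
    then show ?thesis
      using le[OF \<open>p \<in> \<Omega>\<close>] e by (simp add: norm_mult field_simps)
  next
    case True
    define S where "S = {w \<in> \<Omega>. cmod (V w) < 1 - e}"
    have "continuous_on \<Omega> (\<lambda>w. cmod (V w))"
      using contV closure_subset continuous_on_subset by (intro continuous_on_norm) blast
    then have "open S"
      using continuous_open_preimage[OF _ \<open>open \<Omega>\<close> open_lessThan[of "1 - e"]]
      by (simp add: S_def vimage_def Int_def)
    have small: "cmod (V w) \<le> 1 - e" if "w \<in> closure S" for w
    proof (rule continuous_le_on_closure[of S "\<lambda>w. cmod (V w)" w "1 - e"])
      show "continuous_on (closure S) (\<lambda>w. cmod (V w))"
        using contV closure_mono[of S \<Omega>]
        by (intro continuous_on_norm) (auto intro: continuous_on_subset simp: S_def)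
    qed (use that in \<open>auto simp: S_def\<close>)
    have clS: "closure S \<subseteq> \<Omega>"
    proof
      fix w assume w: "w \<in> closure S"
      then have "w \<in> closure \<Omega>"
        using closure_mono[of S \<Omega>] by (auto simp: S_def)
      moreover have "w \<notin> frontier \<Omega>"
        using V[of w] small[OF w] e by auto
      ultimately show "w \<in> \<Omega>"
        using \<open>open \<Omega>\<close> by (simp add: frontier_def interior_open)
    qed
    show ?thesis
    proof (rule maximum_modulus_frontier[of g S])
      show "g holomorphic_on interior S" "continuous_on (closure S) g"
        using holg clS closure_subset \<open>open S\<close> 
        by (auto intro: holomorphic_on_subset holomorphic_on_imp_continuous_on simp: interior_open S_def)
      show "bounded S"
        using \<open>bounded \<Omega>\<close> by (rule bounded_subset) (auto simp: S_def)
      show "p \<in> S"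
        using True \<open>p \<in> \<Omega>\<close> by (simp add: S_def)
      fix w assume "w \<in> frontier S"
      then have w: "w \<in> closure S" "w \<notin> S"
        using \<open>open S\<close> by (auto simp: frontier_def interior_open)
      then have "w \<in> \<Omega>" and "cmod (V w) \<ge> 1 - e"
        using clS by (auto simp: S_def)
      then have "(1 - e) * cmod (g w) \<le> cmod (V w) * cmod (g w)"
        by (intro mult_right_mono) auto
      then show "cmod (g w) \<le> 1 / (1 - e)"
        using le[OF \<open>w \<in> \<Omega>\<close>] e by (simp add: norm_mult field_simps)
    qed
  qed
  have "((\<lambda>e. 1 / (1 - e)) \<longlongrightarrow> 1 / (1 - 0)) (at_right (0::real))"
    by (intro tendsto_intros) auto
  moreover have "eventually (\<lambda>e. cmod (g p) \<le> 1 / (1 - e)) (at_right 0)"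
    using eventually_at_right_real[of 0 1] by (rule eventually_mono) (auto intro!: bound)
  ultimately show ?thesis
    using tendsto_lowerbound[of "\<lambda>e. 1 / (1 - e)" 1 "at_right (0::real)"] by simp
qed

lemma zorder_nonneg:
  assumes "f holomorphic_on S" "open S" "connected S" "z \<in> S" "\<exists>w\<in>S. f w \<noteq> 0"
  shows "zorder f z \<ge> 0"
  using zorder_exist_zero[OF assms] by (auto split: if_splits)

text \<open>Induction splits off one point at a time. Off \<open>a\<close> the previous quotient is
  divided by the power of w - a; near \<open>a\<close> the local factor \<open>h\<close> of
  \<open>f\<close> divided by the earlier product \<open>P\<close> takes over. The two agree on the
  overlap, since either one times \<open>P\<close> and that power gives \<open>f\<close>.\<close>

lemma holomorphic_factor_zeros:
  assumes "f holomorphic_on S" "open S" "connected S" "\<exists>w\<in>S. f w \<noteq> 0"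
    and "finite A" "A \<subseteq> S"
  shows "\<exists>g. g holomorphic_on S \<and>
    (\<forall>w\<in>S. f w = g w * (\<Prod>a\<in>A. (w - a) ^ nat (zorder f a)))"
  using \<open>finite A\<close> \<open>A \<subseteq> S\<close>
proof (induction A)
  case empty
  then show ?case
    using assms(1) by auto
next
  case (insert a A)
  define n where "n = nat (zorder f a)"
  define P where "P = (\<lambda>w. \<Prod>b\<in>A. (w - b) ^ nat (zorder f b))"
  obtain g where g: "g holomorphic_on S" and fg: "\<And>w. w \<in> S \<Longrightarrow> f w = g w * P w"
    using insert unfolding P_def by auto
  obtain h r where r: "r > 0" "cball a r \<subseteq> S" "h holomorphic_on cball a r"
    and fh: "\<And>w. w \<in> cball a r \<Longrightarrow> f w = h w * (w - a) ^ n"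
  proof -
    have "a \<in> S"
      using insert.prems by simp
    from zorder_exist_zero[OF assms(1-3) this assms(4)] that show thesis
      unfolding n_def by blast
  qed
  have P: "P w \<noteq> 0" if "w \<notin> A" for w
    using that \<open>finite A\<close> by (auto simp: P_def)
  define G where "G = (\<lambda>w. if w = a then h a / P a else g w / (w - a) ^ n)"
  have "G holomorphic_on S - {a} \<longleftrightarrow> (\<lambda>w. g w / (w - a) ^ n) holomorphic_on S - {a}"
    by (rule holomorphic_cong) (auto simp: G_def)
  then have 1: "G holomorphic_on S - {a}"
    using g by (auto intro!: holomorphic_intros intro: holomorphic_on_subset)
  have "G holomorphic_on ball a r - A \<longleftrightarrow> (\<lambda>w. h w / P w) holomorphic_on ball a r - A"
  proof (rule holomorphic_cong)
    fix w assume w: "w \<in> ball a r - A"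
    then have "g w * P w = h w * (w - a) ^ n"
      using fg[of w] fh[of w] r(2) by (auto simp: subset_eq)
    then show "G w = h w / P w"
      using P[of w] w by (cases "w = a") (auto simp: G_def frac_eq_eq)
  qed auto
  moreover have "(\<lambda>w. h w / P w) holomorphic_on ball a r - A"
    using r(3) P unfolding P_def
    by (intro holomorphic_intros) (auto intro: holomorphic_on_subset)
  ultimately have 2: "G holomorphic_on ball a r - A"
    by simp
  \<comment> \<open>As \<open>a\<close> is not in \<open>A\<close>, this open set still contains
    \<open>a\<close>, so together with \<open>S - {a}\<close> it covers \<open>S\<close>.\<close>
  have "open (ball a r - A)"
    using \<open>finite A\<close> by (intro open_Diff finite_imp_closed) auto
  with 1 2 \<open>open S\<close> have "G holomorphic_on (S - {a}) \<union> (ball a r - A)"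
    by (intro holomorphic_on_Un) auto
  moreover have "(S - {a}) \<union> (ball a r - A) = S"
    using r insert by auto
  moreover have "f w = G w * (\<Prod>b\<in>insert a A. (w - b) ^ nat (zorder f b))" if "w \<in> S" for w
  proof (cases "w = a")
    case True
    have "f a = h a * (a - a) ^ n"
      using fh[of a] r by simp
    moreover have "P a \<noteq> 0"
      using P insert by blast
    ultimately show ?thesis
      using insert(1,2) True unfolding n_def P_def
      by (simp add: G_def n_def P_def)
  next
    case False
    then show ?thesis
      using fg[OF that] insert by (simp add: G_def n_def P_def)
  qed
  ultimately show ?case
    by auto
qed

subsection \<open>Blaschke factors of an orthogonal lune\<close>

text \<open>For \<open>\<bar>c\<bar> > 1\<close> this is the power of the point \<open>w\<close> with respect to the circle
  centred at \<open>c\<close> that is orthogonal to the unit circle; it is negative inside that circle.\<close>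
definition orth_defect :: "complex \<Rightarrow> complex \<Rightarrow> real" where
  "orth_defect c w = (cmod w)\<^sup>2 + 1 - 2 * Re (cnj c * w)"

text \<open>The Blaschke factor of \<open>a\<close> divided by that of the reflection of \<open>a\<close> in the
  orthogonal circle, so that the modulus is 1 on both arcs bounding the lune.\<close>
definition lune_blaschke :: "complex \<Rightarrow> complex \<Rightarrow> complex \<Rightarrow> complex" where
  "lune_blaschke c a w =
     ((w - a) * (a + w - c - cnj c * a * w)) / ((1 - cnj a * w) * (1 + cnj a * w - cnj c * w - c * cnj a))"

lemma norm_1_minus_cnj_mult:
  "(cmod (1 - cnj a * w))\<^sup>2 = (cmod (w - a))\<^sup>2 + (1 - (cmod a)\<^sup>2) * (1 - (cmod w)\<^sup>2)"
  unfolding cmod_power2 by (simp add: algebra_simps power2_eq_square)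

text \<open>For a \<noteq> c let a' be the reflection of a in the orthogonal circle. The expression
  is (a - c) (1 - cnj a' w), and the one in the next lemma is cnj (a - c) (w - a'): numerator and
  denominator of the inverted Blaschke factor of a'.\<close>

lemma norm_reflected_numerator:
  "(cmod (a + w - c - cnj c * a * w))\<^sup>2
     = ((cmod c)\<^sup>2 - 1) * (cmod (1 - cnj a * w))\<^sup>2 + orth_defect c a * orth_defect c w"
  unfolding orth_defect_def cmod_power2 by (simp add: algebra_simps power2_eq_square)

lemma norm_reflected_denominator:
  "(cmod (1 + cnj a * w - cnj c * w - c * cnj a))\<^sup>2
     = ((cmod c)\<^sup>2 - 1) * (cmod (w - a))\<^sup>2 + orth_defect c a * orth_defect c w"
  unfolding orth_defect_def cmod_power2 by (simp add: algebra_simps power2_eq_square)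

lemma orth_defect_eq_power: "orth_defect c w = (cmod (w - c))\<^sup>2 - ((cmod c)\<^sup>2 - 1)"
  unfolding orth_defect_def cmod_power2 by (simp add: algebra_simps power2_eq_square)

context
  fixes a c w :: complex
  assumes c: "cmod c > 1" and a: "cmod a < 1" "orth_defect c a < 0"
    and w: "cmod w \<le> 1" "orth_defect c w \<le> 0"
begin

lemma one_minus_cnj_mult_nz: "1 - cnj a * w \<noteq> 0"
proof
  assume "1 - cnj a * w = 0"
  then have "cmod (cnj a * w) = 1" by (metis norm_one right_minus_eq)
  moreover have "cmod (cnj a * w) \<le> cmod a * 1"
    using w by (simp add: norm_mult mult_left_le)
  ultimately show False using a by simp
qed

lemma reflected_numerator_nz: "a + w - c - cnj c * a * w \<noteq> 0"
proof -
  have "((cmod c)\<^sup>2 - 1) * (cmod (1 - cnj a * w))\<^sup>2 > 0"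
    using c one_minus_cnj_mult_nz by simp
  moreover have "orth_defect c a * orth_defect c w \<ge> 0"
    using a w by (simp add: mult_nonpos_nonpos)
  ultimately have "(cmod (a + w - c - cnj c * a * w))\<^sup>2 > 0"
    unfolding norm_reflected_numerator by linarith
  then show ?thesis by auto
qed

lemma reflected_denominator_nz: "1 + cnj a * w - cnj c * w - c * cnj a \<noteq> 0"
proof -
  have 1: "orth_defect c a * orth_defect c w \<ge> 0"
    using a w by (simp add: mult_nonpos_nonpos)
  have "(cmod (1 + cnj a * w - cnj c * w - c * cnj a))\<^sup>2 > 0"
  proof (cases "w = a")
    case True
    then show ?thesis
      unfolding norm_reflected_denominator using a by (simp add: mult_neg_neg)
  next
    case False
    then have "((cmod c)\<^sup>2 - 1) * (cmod (w - a))\<^sup>2 > 0"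
      using c by simp
    then show ?thesis
      unfolding norm_reflected_denominator using 1 by linarith
  qed
  then show ?thesis by auto
qed

text \<open>Inserting the three norm identities, the terms with |c|^2 - 1 cancel and a single
  product remains. It vanishes when |w| = 1 and when w lies on the orthogonal circle, and is
  positive inside the lune.\<close>

lemma norm_lune_blaschke:
  "(cmod (lune_blaschke c a w))\<^sup>2 = 1 - orth_defect c a * orth_defect c w
      * (1 - (cmod a)\<^sup>2) * (1 - (cmod w)\<^sup>2)
      / ((cmod (1 - cnj a * w))\<^sup>2 * (cmod (1 + cnj a * w - cnj c * w - c * cnj a))\<^sup>2)"
proof -
  define D Y X where "D = (cmod (1 - cnj a * w))\<^sup>2"
    and "Y = (cmod (1 + cnj a * w - cnj c * w - c * cnj a))\<^sup>2"
    and "X = (cmod (a + w - c - cnj c * a * w))\<^sup>2"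
  have nz: "D \<noteq> 0" "Y \<noteq> 0"
    using one_minus_cnj_mult_nz reflected_denominator_nz by (auto simp: D_def Y_def)
  have "(cmod (lune_blaschke c a w))\<^sup>2 = (cmod (w - a))\<^sup>2 * X / (D * Y)"
    unfolding lune_blaschke_def D_def X_def Y_def
    by (simp add: norm_mult norm_divide power_mult_distrib power_divide)
  also have "(cmod (w - a))\<^sup>2 * X
      = D * Y - orth_defect c a * orth_defect c w * (1 - (cmod a)\<^sup>2) * (1 - (cmod w)\<^sup>2)"
    unfolding X_def Y_def norm_reflected_numerator norm_reflected_denominator
    unfolding D_def norm_1_minus_cnj_mult by (simp add: algebra_simps)
  finally show ?thesis
    using nz by (simp add: diff_divide_distrib D_def Y_def)
qed

end

section \<open>Simple poles just outside the disc\<close>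

definition outer_pole :: "complex \<Rightarrow> real \<Rightarrow> complex \<Rightarrow> complex" where
  "outer_pole e r w = e / (of_real (1 + r) * e - w)"

lemma outer_pole_denominator:
  assumes "cmod e = 1" "r > 0" "cmod w \<le> 1"
  shows "cmod (of_real (1 + r) * e - w) \<ge> 1 + r - cmod w"
proof -
  have "cmod (of_real (1 + r) * e) = 1 + r"
    using assms by (simp add: norm_mult del: of_real_add)
  then show ?thesis
    using norm_triangle_ineq2[of "of_real (1 + r) * e" w] by linarith
qed

lemma outer_pole_denominator_nz:
  assumes "cmod e = 1" "r > 0" "cmod w \<le> 1"
  shows "of_real (1 + r) * e - w \<noteq> 0"
  using outer_pole_denominator[OF assms] assms by (auto simp del: of_real_add)

text \<open>The real part is Re (e cnj ((1 + r) e - w)) over the squared distance to the pole, and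
  that numerator equals 1 + r - Re (e cnj w), which is at least r on the closed disc. The function
  thus behaves like a Poisson kernel of width r at e.\<close>

lemma Re_outer_pole_ge:
  assumes "cmod e = 1" "r > 0" "cmod w \<le> 1"
  shows "Re (outer_pole e r w) \<ge> r / (cmod (of_real (1 + r) * e - w))\<^sup>2"
proof -
  have "(Re e)\<^sup>2 + (Im e)\<^sup>2 = 1"
    using assms(1) cmod_power2[of e] by simp
  then have "(1 + r) * (Re e)\<^sup>2 + (1 + r) * (Im e)\<^sup>2 = 1 + r"
    by (metis distrib_left mult.right_neutral)
  then have "Re (e * cnj (of_real (1 + r) * e - w)) = 1 + r - Re (e * cnj w)"
    by (simp add: algebra_simps power2_eq_square)
  moreover have "Re (e * cnj w) \<le> 1"
    using complex_Re_le_cmod[of "e * cnj w"] assms by (simp add: norm_mult)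
  ultimately have "Re (e * cnj (of_real (1 + r) * e - w)) \<ge> r"
    by simp
  then show ?thesis
    unfolding outer_pole_def complex_div_cnj[of e] by (simp add: divide_right_mono del: of_real_add)
qed

lemma Re_outer_pole_nonneg:
  assumes "cmod e = 1" "r > 0" "cmod w \<le> 1"
  shows "Re (outer_pole e r w) \<ge> 0"
  using Re_outer_pole_ge[OF assms] assms
  by (meson divide_nonneg_nonneg less_imp_le order_trans zero_le_power2)

lemma Re_outer_pole_le:
  assumes "cmod e = 1" "r > 0" "cmod w < 1"
  shows "Re (outer_pole e r w) \<le> 1 / (1 - cmod w)"
proof -
  have "cmod (outer_pole e r w) \<le> 1 / (1 - cmod w)"
    unfolding outer_pole_def norm_divide assms(1)
    using outer_pole_denominator[of e r w] assms by (intro divide_left_mono) (auto intro!: mult_pos_pos simp del: of_real_add)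
  then show ?thesis
    using complex_Re_le_cmod order_trans by blast
qed

section \<open>Barriers attached to a single zero\<close>

lemma one_minus_norm_le_infdist:
  assumes "E \<subseteq> sphere 0 1" "E \<noteq> {}"
  shows "1 - cmod w \<le> infdist w E"
proof -
  have "1 - cmod w \<le> dist w e" if "e \<in> E" for e
  proof -
    have "cmod e = 1" using that assms by auto
    then show ?thesis
      using norm_triangle_ineq2[of e w] by (simp add: dist_norm norm_minus_commute)
  qed
  then show ?thesis
    using assms by (auto simp: infdist_def intro!: cINF_greatest)
qed

text \<open>The pole placed outside the disc near \<open>a\<close>, at the scale \<open>x\<close> of its distance to \<open>E\<close>,
  compensates the loss of \<open>\<bar>lune_blaschke c a\<bar>\<close> on the curve at distance \<open>\<eta> * x\<close> from \<open>E\<close>,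
  at a cost of only \<open>O(\<eta> * (1 - \<bar>a\<bar>))\<close> at a fixed interior point.\<close>
lemma norm_barrier_ge_1:
  assumes c: "cmod c > 1" and a: "cmod a < 1" "orth_defect c a < 0"
    and w: "cmod w \<le> 1" "orth_defect c w \<le> 0"
    and E: "E \<subseteq> sphere 0 1" "E \<noteq> {}"
    and \<eta>: "0 < \<eta>" "\<eta> \<le> 1/32" and x: "x > 0" "infdist a E \<ge> x"
    and boundary: "cmod w = 1 \<or> orth_defect c w = 0 \<or> infdist w E = \<eta> * x"
  shows "cmod (lune_blaschke c a w * exp (of_real (100 * \<eta> * (1 - cmod a)) * outer_pole (sgn a) x w)) \<ge> 1"
proof -
  have "a \<noteq> 0"
    using a by (auto simp: orth_defect_def)
  then have e: "cmod (sgn a) = 1"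
    by (simp add: norm_sgn)
  \<comment> \<open>\<open>S\<close> is the loss 1 - |B|^2 of the Blaschke factor B at w, and
    \<open>q\<close> below is the logarithmic gain of the pole term. The aim is (1 - S) exp (2 q)
    \<ge> 1.\<close>
  define S where "S = orth_defect c a * orth_defect c w * (1 - (cmod a)\<^sup>2) * (1 - (cmod w)\<^sup>2)
      / ((cmod (1 - cnj a * w))\<^sup>2 * (cmod (1 + cnj a * w - cnj c * w - c * cnj a))\<^sup>2)"
  define q where "q = 100 * \<eta> * (1 - cmod a) * Re (outer_pole (sgn a) x w)"
  have B: "(cmod (lune_blaschke c a w))\<^sup>2 = 1 - S"
    unfolding S_def by (rule norm_lune_blaschke[OF c a w])
  have norm: "cmod (lune_blaschke c a w * exp (of_real (100 * \<eta> * (1 - cmod a)) * outer_pole (sgn a) x w))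
      = cmod (lune_blaschke c a w) * exp q"
    by (simp add: norm_mult q_def)
  have q0: "q \<ge> 0"
    unfolding q_def using Re_outer_pole_nonneg[OF e x(1) w(1)] \<eta> a by (intro mult_nonneg_nonneg) auto
  show ?thesis
  proof (cases "cmod w = 1 \<or> orth_defect c w = 0")
    case True
    then have "S = 0"
      by (auto simp: S_def)
    then have "cmod (lune_blaschke c a w) = 1"
      using B power2_eq_iff_nonneg[of "cmod (lune_blaschke c a w)" 1] by simp
    then show ?thesis
      using q0 norm by simp
  next
    case False
    then have dw: "infdist w E = \<eta> * x"
      using boundary by auto
    define D where "D = cmod (w - a)"
    have "infdist a E \<le> infdist w E + dist a w"
      by (rule infdist_triangle)
    then have "x \<le> \<eta> * x + D"
      using x dw by (simp add: D_def dist_norm norm_minus_commute)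
    moreover have "\<eta> * x \<le> x / 32"
      using \<eta> x mult_right_mono[of \<eta> "1/32" x] by simp
    \<comment> \<open>The point w is within \<eta> x of E while a is at least x away from E, so w
      and a are separated on the scale x.\<close>
    ultimately have xD: "x \<le> 2 * D"
      using x by linarith
    then have "D > 0"
      using x by linarith
    have w1: "1 - cmod w \<le> \<eta> * x"
      using one_minus_norm_le_infdist[OF E, of w] dw by simp
    have "cmod w - cmod a \<le> D"
      unfolding D_def by (rule norm_triangle_ineq2)
    then have a1: "1 - cmod a \<le> 2 * D"
      using w1 xD \<open>\<eta> * x \<le> x / 32\<close> \<open>D > 0\<close> by linarith
    have "4 * \<eta> * x * (1 - cmod a) / D\<^sup>2 \<le> 4 * \<eta> * (2 * D) * (2 * D) / D\<^sup>2"
      using a1 xD \<eta> x a \<open>D > 0\<close> by (intro divide_right_mono mult_mono) auto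
    also have "\<dots> = 16 * \<eta>"
      using \<open>D > 0\<close> by (simp add: power2_eq_square)
    finally have small: "4 * \<eta> * x * (1 - cmod a) / D\<^sup>2 \<le> 1/2"
      using \<eta> by linarith
    have S: "S \<le> 4 * \<eta> * x * (1 - cmod a) / D\<^sup>2"
    proof -
      let ?\<pi> = "orth_defect c a * orth_defect c w" and ?Y = "(cmod (1 + cnj a * w - cnj c * w - c * cnj a))\<^sup>2"
        and ?N = "(cmod (1 - cnj a * w))\<^sup>2"
      have "((cmod c)\<^sup>2 - 1) * (cmod (w - a))\<^sup>2 \<ge> 0"
        using c by simp
      then have "?\<pi> \<le> ?Y"
        unfolding norm_reflected_denominator by linarith
      moreover have "?Y > 0"
        using reflected_denominator_nz[OF c a w] by simp
      ultimately have 1: "?\<pi> / ?Y \<le> 1" by simp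
      have sq: "1 - (cmod a)\<^sup>2 = (1 - cmod a) * (1 + cmod a)" "1 - (cmod w)\<^sup>2 = (1 - cmod w) * (1 + cmod w)"
        by (simp_all add: algebra_simps power2_eq_square)
      have "(1 - (cmod a)\<^sup>2) * (1 - (cmod w)\<^sup>2) \<ge> 0"
        unfolding sq using a w by (intro mult_nonneg_nonneg) auto
      then have N: "D\<^sup>2 \<le> ?N"
        unfolding norm_1_minus_cnj_mult D_def by simp
      have 2: "(1 - (cmod a)\<^sup>2) * (1 - (cmod w)\<^sup>2) \<le> ((1 - cmod a) * 2) * ((\<eta> * x) * 2)"
        unfolding sq using a w w1 \<eta> x by (intro mult_mono mult_nonneg_nonneg) auto
      have "S = (?\<pi> / ?Y) * ((1 - (cmod a)\<^sup>2) * (1 - (cmod w)\<^sup>2) / ?N)"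
        by (simp add: S_def mult_ac)
      also have "\<dots> \<le> 1 * ((1 - (cmod a)\<^sup>2) * (1 - (cmod w)\<^sup>2) / ?N)"
        using 1 \<open>(1 - (cmod a)\<^sup>2) * (1 - (cmod w)\<^sup>2) \<ge> 0\<close> by (intro mult_right_mono) auto
      also have "\<dots> \<le> (((1 - cmod a) * 2) * ((\<eta> * x) * 2)) / D\<^sup>2"
        unfolding mult_1 using 2 N \<open>D > 0\<close> a \<eta> x by (intro frac_le) auto
      finally show ?thesis by (simp add: mult_ac)
    qed
    \<comment> \<open>The pole (1 + x) \<open>sgn a\<close> is within x + (1 - |a|) + D \<le> 5 D of
      w. The constant 100 = 4 * 25 offsets the resulting factor 25 and the 4 in the bound for
      \<open>S\<close>.\<close>
    have "4 * \<eta> * x * (1 - cmod a) / D\<^sup>2 \<le> q"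
    proof -
      have "cmod (of_real (1 + x) * sgn a - w) \<le> 5 * D"
      proof -
        have "cmod (of_real (1 + x) * sgn a - w) = cmod (of_real x * sgn a + (sgn a - a) + (a - w))"
          by (simp add: algebra_simps)
        also have "\<dots> \<le> cmod (of_real x * sgn a) + cmod (sgn a - a) + cmod (a - w)"
          by (intro norm_triangle_le add_mono norm_triangle_ineq) auto
        also have "cmod (of_real x * sgn a) = x"
          using x e by (simp add: norm_mult)
        also have "sgn a - a = of_real (1 - cmod a) * sgn a"
          using \<open>a \<noteq> 0\<close> by (simp add: sgn_eq field_simps)
        also have "cmod (of_real (1 - cmod a) * sgn a) = 1 - cmod a"
          unfolding norm_mult e norm_of_real using a by simp
        finally show ?thesis
          using xD a1 by (simp add: D_def norm_minus_commute)
      qed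
      then have "x / (5 * D)\<^sup>2 \<le> x / (cmod (of_real (1 + x) * sgn a - w))\<^sup>2"
        using outer_pole_denominator_nz[OF e x(1) w(1)] x \<open>D > 0\<close>
        by (intro divide_left_mono power_mono) (auto simp del: of_real_add)
      also have "\<dots> \<le> Re (outer_pole (sgn a) x w)"
        by (rule Re_outer_pole_ge[OF e x(1) w(1)])
      finally have "100 * \<eta> * (1 - cmod a) * (x / (5 * D)\<^sup>2) \<le> q"
        unfolding q_def using \<eta> a by (intro mult_left_mono) auto
      moreover have "100 * \<eta> * (1 - cmod a) * (x / (5 * D)\<^sup>2) = 4 * \<eta> * x * (1 - cmod a) / D\<^sup>2"
        using \<open>D > 0\<close> by (simp add: field_simps)
      ultimately show ?thesis by simp
    qed
    with S have "S \<le> q" "S \<le> 1/2"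
      using small by auto
    \<comment> \<open>For 0 \<le> S \<le> 1/2 the factor 1 + 2 S makes up for 1 - S, and it is at
      most exp (2 q). The bound S \<le> 1/2 is what \<eta> \<le> 1/32 provides.\<close>
    have "1 \<le> (1 - S) * (1 + 2 * S)" if "S \<ge> 0"
      using \<open>S \<le> 1/2\<close> that mult_nonneg_nonneg[of S "1 - 2 * S"] by (simp add: algebra_simps)
    moreover have "S \<ge> 0"
    proof -
      have "orth_defect c a * orth_defect c w \<ge> 0"
        using a w by (simp add: mult_nonpos_nonpos)
      moreover have "0 \<le> 1 - (cmod a)\<^sup>2" "0 \<le> 1 - (cmod w)\<^sup>2"
        using a w by (auto simp: abs_square_le_1)
      ultimately have "0 \<le> orth_defect c a * orth_defect c w * (1 - (cmod a)\<^sup>2) * (1 - (cmod w)\<^sup>2)"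
        by (metis mult_nonneg_nonneg)
      then show ?thesis
        unfolding S_def by (rule divide_nonneg_nonneg) simp
    qed
    ultimately have "1 \<le> (1 - S) * (1 + 2 * S)" by simp
    also have "\<dots> \<le> (1 - S) * exp (2 * q)"
      using \<open>S \<le> 1/2\<close> \<open>S \<le> q\<close> exp_ge_add_one_self[of "2 * q"] by (intro mult_left_mono) linarith+
    also have "\<dots> = (cmod (lune_blaschke c a w) * exp q)\<^sup>2"
      by (simp add: B power_mult_distrib exp_double)
    finally have "1\<^sup>2 \<le> (cmod (lune_blaschke c a w) * exp q)\<^sup>2" by simp
    then show ?thesis
      unfolding norm by (rule power2_le_imp_le) simp
  qed
qed

text \<open>At the fixed point p the loss of the Blaschke factor is at least a constant times 1 -
  |a|, giving a decay exp (-\<kappa> (1 - |a|)). The smallness of \<eta> lets the pole term consume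
  at most half of this exponent.\<close>

lemma norm_barrier_le:
  assumes c: "1 < cmod c" "cmod c \<le> 2" and a: "cmod a < 1" "orth_defect c a \<le> - s" and s: "s > 0"
    and p: "cmod p < 1" "orth_defect c p < 0"
    and \<eta>: "0 < \<eta>" "x > 0"
    and \<kappa>: "\<kappa> = s * (- orth_defect c p) * (1 - (cmod p)\<^sup>2) / 288"
    and le: "100 * \<eta> / (1 - cmod p) \<le> \<kappa> / 2"
  shows "cmod (lune_blaschke c a p * exp (of_real (100 * \<eta> * (1 - cmod a)) * outer_pole (sgn a) x p))
    \<le> exp (- (\<kappa> / 2) * (1 - cmod a))"
proof -
  have "a \<noteq> 0"
    using a s by (auto simp: orth_defect_def)
  then have e: "cmod (sgn a) = 1"
    by (simp add: norm_sgn)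
  define S where "S = orth_defect c a * orth_defect c p * (1 - (cmod a)\<^sup>2) * (1 - (cmod p)\<^sup>2)
      / ((cmod (1 - cnj a * p))\<^sup>2 * (cmod (1 + cnj a * p - cnj c * p - c * cnj a))\<^sup>2)"
  have a': "orth_defect c a < 0"
    using a s by linarith
  have p1: "1 - (cmod p)\<^sup>2 > 0" and a1: "1 - (cmod a)\<^sup>2 > 0"
    using p a by (auto simp: abs_square_less_1)
  have p': "cmod p \<le> 1" "orth_defect c p \<le> 0"
    using p by auto
  have N: "cmod (1 - cnj a * p) \<le> 2"
    using norm_triangle_ineq4[of 1 "cnj a * p"] mult_mono[of "cmod a" 1 "cmod p" 1] a p
    by (simp add: norm_mult)
  have Y: "cmod (1 + cnj a * p - cnj c * p - c * cnj a) \<le> 6"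
  proof -
    have "cmod (1 + cnj a * p - cnj c * p - c * cnj a) \<le> 1 + cmod (cnj a * p) + cmod (cnj c * p) + cmod (c * cnj a)"
      using norm_triangle_ineq[of 1 "cnj a * p"] norm_triangle_ineq4[of "1 + cnj a * p" "cnj c * p"]
        norm_triangle_ineq4[of "1 + cnj a * p - cnj c * p" "c * cnj a"]
      unfolding norm_one by linarith
    also have "\<dots> \<le> 1 + 1 * 1 + 2 * 1 + 2 * 1"
      unfolding norm_mult complex_mod_cnj using a p c by (intro add_mono mult_mono) auto
    finally show ?thesis by simp
  qed
  \<comment> \<open>The denominators are bounded by 2 and 6 in modulus; 288 is 2 * 2^2 * 6^2, the
    first 2 coming from the square of |B|.\<close>
  have "2 * \<kappa> * (1 - cmod a) = s * (- orth_defect c p) * (1 - cmod a) * (1 - (cmod p)\<^sup>2) / (2\<^sup>2 * 6\<^sup>2)"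
    by (simp add: \<kappa>)
  also have "\<dots> \<le> (- orth_defect c a) * (- orth_defect c p) * (1 - (cmod a)\<^sup>2) * (1 - (cmod p)\<^sup>2)
      / ((cmod (1 - cnj a * p))\<^sup>2 * (cmod (1 + cnj a * p - cnj c * p - c * cnj a))\<^sup>2)"
  proof (intro frac_le mult_mono power_mono N Y mult_nonneg_nonneg mult_pos_pos)
    show "1 - cmod a \<le> 1 - (cmod a)\<^sup>2"
      using a mult_left_le[of "cmod a" "cmod a"] by (simp add: power2_eq_square)
  qed (use a a' s p p1 a1 one_minus_cnj_mult_nz[OF c(1) a(1) a' p'] reflected_denominator_nz[OF c(1) a(1) a' p'] in auto)
  finally have S: "2 * \<kappa> * (1 - cmod a) \<le> S"
    by (simp add: S_def)
  have "(cmod (lune_blaschke c a p))\<^sup>2 = 1 - S"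
    unfolding S_def by (rule norm_lune_blaschke[OF c(1) a(1) a' p'])
  also have "\<dots> \<le> exp (- S)"
    using exp_ge_add_one_self[of "- S"] by simp
  also have "\<dots> \<le> exp (- (2 * \<kappa> * (1 - cmod a)))"
    using S by simp
  also have "\<dots> = (exp (- (\<kappa> * (1 - cmod a))))\<^sup>2"
    by (simp add: exp_double[symmetric])
  finally have B: "cmod (lune_blaschke c a p) \<le> exp (- (\<kappa> * (1 - cmod a)))"
    by (rule power2_le_imp_le) simp
  have "100 * \<eta> * (1 - cmod a) * Re (outer_pole (sgn a) x p) \<le> 100 * \<eta> * (1 - cmod a) * (1 / (1 - cmod p))"
    using Re_outer_pole_le[OF e \<eta>(2) p(1)] \<eta> a by (intro mult_left_mono) auto
  also have "\<dots> = (100 * \<eta> / (1 - cmod p)) * (1 - cmod a)"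
    by simp
  also have "\<dots> \<le> \<kappa> / 2 * (1 - cmod a)"
    using le a by (intro mult_right_mono) auto
  finally have Q: "exp (100 * \<eta> * (1 - cmod a) * Re (outer_pole (sgn a) x p)) \<le> exp (\<kappa> / 2 * (1 - cmod a))"
    by simp
  have "cmod (lune_blaschke c a p * exp (of_real (100 * \<eta> * (1 - cmod a)) * outer_pole (sgn a) x p))
      = cmod (lune_blaschke c a p) * exp (100 * \<eta> * (1 - cmod a) * Re (outer_pole (sgn a) x p))"
    by (simp add: norm_mult)
  also have "\<dots> \<le> exp (- (\<kappa> * (1 - cmod a))) * exp (\<kappa> / 2 * (1 - cmod a))"
    using B Q by (intro mult_mono) auto
  also have "\<dots> = exp (- (\<kappa> / 2) * (1 - cmod a))"
    by (simp add: exp_add[symmetric] field_simps)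
  finally show ?thesis .
qed

subsection \<open>Zeros at a given distance from the boundary set\<close>

definition orth_lune :: "complex \<Rightarrow> complex set" where
  "orth_lune c = {w. cmod w < 1 \<and> orth_defect c w < 0}"

text \<open>As an intersection of two discs the lune is open and convex, hence connected.\<close>

lemma orth_lune_eq_balls:
  assumes "cmod c > 1"
  shows "orth_lune c = ball 0 1 \<inter> ball c (sqrt ((cmod c)\<^sup>2 - 1))"
proof -
  have "(orth_defect c w < 0) = (dist c w < sqrt ((cmod c)\<^sup>2 - 1))" for w
    unfolding orth_defect_eq_power
    using real_less_rsqrt[of "cmod (w - c)" "(cmod c)\<^sup>2 - 1"]
      real_sqrt_less_mono[of "(cmod (w - c))\<^sup>2" "(cmod c)\<^sup>2 - 1"] real_sqrt_less_iff[of "(cmod (w - c))\<^sup>2"]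
    by (auto simp: dist_norm norm_minus_commute)
  then show ?thesis
    unfolding orth_lune_def by (intro set_eqI) simp
qed

lemma open_orth_lune: "cmod c > 1 \<Longrightarrow> open (orth_lune c)"
  by (simp add: orth_lune_eq_balls open_Int)

lemma connected_orth_lune: "cmod c > 1 \<Longrightarrow> connected (orth_lune c)"
  by (simp add: orth_lune_eq_balls convex_Int convex_connected)

text \<open>Divide \<open>f\<close> by exp K and by the barrier of every point of \<open>A\<close>,
  repeated according to its order. The barriers are at least 1 in modulus on the frontier of
  \<open>\<Omega>\<close>, so the quotient is at most 1 at p. There each barrier is at most exp
  (-(\<kappa>/2) (1 - |a|)); taking logarithms bounds the weighted sum.\<close>

lemma zero_sum_bound:
  assumes c: "1 < cmod c" "cmod c \<le> 2" and E: "E \<subseteq> sphere 0 1" "E \<noteq> {}"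
    and f: "f holomorphic_on orth_lune c" and p: "p \<in> orth_lune c" "f p \<noteq> 0"
    and K: "K holomorphic_on orth_lune c"
    and fK: "\<And>w. w \<in> orth_lune c \<Longrightarrow> infdist w E > \<eta> * x \<Longrightarrow> cmod (f w) \<le> exp (Re (K w))"
    and A: "finite A" "A \<subseteq> orth_lune c" "\<And>a. a \<in> A \<Longrightarrow> orth_defect c a \<le> - s \<and> infdist a E \<ge> x"
    and s: "s > 0" and x: "x > 0" and \<eta>: "0 < \<eta>" "\<eta> \<le> 1/32"
    and xp: "infdist p E > \<eta> * x"
    and \<kappa>: "\<kappa> = s * (- orth_defect c p) * (1 - (cmod p)\<^sup>2) / 288"
    and le: "100 * \<eta> / (1 - cmod p) \<le> \<kappa> / 2"
  shows "\<kappa> / 2 * (\<Sum>a\<in>A. real_of_int (zorder f a) * (1 - cmod a)) \<le> Re (K p) - ln (cmod (f p))"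
proof -
  let ?G = "orth_lune c"
  have G: "open ?G" "connected ?G" "\<exists>w\<in>?G. f w \<noteq> 0"
    using open_orth_lune[OF c(1)] connected_orth_lune[OF c(1)] p by blast+
  define n where "n = (\<lambda>a. nat (zorder f a))"
  obtain h where h: "h holomorphic_on ?G" and fh: "\<And>w. w \<in> ?G \<Longrightarrow> f w = h w * (\<Prod>a\<in>A. (w - a) ^ n a)"
    using holomorphic_factor_zeros[OF f G A(1,2)] unfolding n_def by blast
  have ord: "real_of_int (zorder f a) = n a" if "a \<in> A" for a
  proof -
    have "zorder f a \<ge> 0"
      using that A(2) by (intro zorder_nonneg[OF f G(1,2) _ G(3)]) auto
    then show ?thesis by (simp add: n_def)
  qed
  define \<Omega> where "\<Omega> = {w \<in> ?G. infdist w E > \<eta> * x}"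
  \<comment> \<open>A closed set containing the closure of \<open>\<Omega>\<close>, on which none of
    the denominators vanishes.\<close>
  define H where "H = {w. cmod w \<le> 1 \<and> orth_defect c w \<le> 0 \<and> infdist w E \<ge> \<eta> * x}"
  have "open \<Omega>"
  proof -
    have "open ({w. infdist w E > \<eta> * x})"
      by (intro open_Collect_less continuous_intros)
    then show ?thesis
      using open_Int[OF G(1)] by (simp add: \<Omega>_def Collect_conj_eq)
  qed
  have "closed H"
    unfolding H_def orth_defect_def by (intro closed_Collect_conj closed_Collect_le continuous_intros)
  moreover have \<Omega>H: "\<Omega> \<subseteq> H"
    by (auto simp: \<Omega>_def H_def orth_lune_def)
  ultimately have cl: "closure \<Omega> \<subseteq> H"
    by (rule closure_minimal[rotated])
  have "bounded \<Omega>"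
    by (rule bounded_subset[OF bounded_ball[of 0 1]]) (auto simp: \<Omega>_def orth_lune_def)
  define q where "q = (\<lambda>a w. of_real (100 * \<eta> * (1 - cmod a)) * outer_pole (sgn a) x w)"
  \<comment> \<open>The barrier of a without its zero: w - a is left out, so \<open>U a\<close> has
    no zeros on \<open>H\<close> and can be divided out.\<close>
  define U where "U = (\<lambda>a w. (a + w - c - cnj c * a * w)
      / ((1 - cnj a * w) * (1 + cnj a * w - cnj c * w - c * cnj a)) * exp (q a w))"
  have V: "(w - a) * U a w = lune_blaschke c a w * exp (q a w)" for a w
    by (simp add: U_def lune_blaschke_def)
  have Aa: "cmod a < 1" "orth_defect c a < 0" "cmod (sgn a) = 1" if "a \<in> A" for a
  proof -
    show "cmod a < 1" "orth_defect c a < 0"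
      using that A by (auto simp: orth_lune_def)
    then have "a \<noteq> 0"
      by (auto simp: orth_defect_def)
    then show "cmod (sgn a) = 1" by (simp add: norm_sgn)
  qed
  have nz: "1 - cnj a * w \<noteq> 0" "a + w - c - cnj c * a * w \<noteq> 0"
      "1 + cnj a * w - cnj c * w - c * cnj a \<noteq> 0" "of_real (1 + x) * sgn a - w \<noteq> 0" if "a \<in> A" "w \<in> H" for a w
    using one_minus_cnj_mult_nz[OF c(1), of a w] reflected_numerator_nz[OF c(1), of a w]
      reflected_denominator_nz[OF c(1), of a w] outer_pole_denominator_nz[of "sgn a" x w] Aa[OF that(1)] that(2) x
    by (auto simp: H_def)
  have U_nz: "U a w \<noteq> 0" if "a \<in> A" "w \<in> H" for a w
    using nz[OF that] by (simp add: U_def)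
  have U_hol: "U a holomorphic_on \<Omega>" if "a \<in> A" for a
  proof -
    note nz\<Omega> = nz[OF that subsetD[OF \<Omega>H]]
    show ?thesis
      unfolding U_def q_def outer_pole_def by (intro holomorphic_intros no_zero_divisors nz\<Omega>)
  qed
  have U_cont: "continuous_on (closure \<Omega>) (U a)" if "a \<in> A" for a
  proof -
    note nzcl = nz[OF that subsetD[OF cl]]
    show ?thesis
      unfolding U_def q_def outer_pole_def by (intro continuous_intros ballI no_zero_divisors nzcl)
  qed
  define W where "W = (\<lambda>w. \<Prod>a\<in>A. ((w - a) * U a w) ^ n a)"
  \<comment> \<open>Built from the zero-free quotient \<open>h\<close>, so \<open>g\<close> is
    holomorphic across the points of \<open>A\<close>; nevertheless \<open>g * W\<close> is
    \<open>f\<close> times exp (-K), where the growth bound applies.\<close>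
  define g where "g = (\<lambda>w. h w * exp (- K w) / (\<Prod>a\<in>A. U a w ^ n a))"
  have "p \<in> \<Omega>"
    using p xp by (simp add: \<Omega>_def)
  have gW: "g w * W w = f w * exp (- K w)" if "w \<in> \<Omega>" for w
  proof -
    have "(\<Prod>a\<in>A. U a w ^ n a) \<noteq> 0"
      using U_nz \<Omega>H that A(1) by auto
    then show ?thesis
      using fh[of w] that by (simp add: g_def W_def \<Omega>_def power_mult_distrib prod.distrib)
  qed
  have "cmod (g p) \<le> 1"
  proof (rule modulus_le_1_by_boundary[OF \<open>open \<Omega>\<close> \<open>bounded \<Omega>\<close> _ _ _ _ \<open>p \<in> \<Omega>\<close>])
    show "g holomorphic_on \<Omega>"
      unfolding g_def using U_nz \<Omega>H U_hol A(1)
      by (intro holomorphic_intros holomorphic_on_subset[OF h] holomorphic_on_subset[OF K]) (auto simp: \<Omega>_def)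
    show "continuous_on (closure \<Omega>) W"
      unfolding W_def using U_cont by (intro continuous_intros) auto
    show "cmod (g w * W w) \<le> 1" if "w \<in> \<Omega>" for w
    proof -
      have "cmod (g w * W w) = cmod (f w) * exp (- Re (K w))"
        by (simp add: gW[OF that] norm_mult)
      also have "\<dots> \<le> exp (Re (K w)) * exp (- Re (K w))"
        using fK[of w] that by (intro mult_right_mono) (auto simp: \<Omega>_def)
      finally show ?thesis by (simp add: exp_minus)
    qed
    show "1 \<le> cmod (W w)" if "w \<in> frontier \<Omega>" for w
    proof -
      have w: "w \<in> H" "w \<notin> \<Omega>"
        using that cl \<open>open \<Omega>\<close> by (auto simp: frontier_def interior_open)
      \<comment> \<open>A point of \<open>H\<close> outside the open set \<open>\<Omega>\<close>
        must turn one of the three defining inequalities into an equality.\<close>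
      then have b: "cmod w = 1 \<or> orth_defect c w = 0 \<or> infdist w E = \<eta> * x"
        by (auto simp: H_def \<Omega>_def orth_lune_def)
      have "1 \<le> cmod ((w - a) * U a w)" if "a \<in> A" for a
        unfolding V q_def using norm_barrier_ge_1[OF c(1) Aa(1,2)[OF that] _ _ E \<eta> x _ b] w A(3)[OF that]
        by (auto simp: H_def)
      then show ?thesis
        unfolding W_def prod_norm[symmetric] norm_power by (intro prod_ge_1) auto
    qed
  qed
  have "cmod (f p) * exp (- Re (K p)) = cmod (g p * W p)"
    by (simp add: gW[OF \<open>p \<in> \<Omega>\<close>] norm_mult)
  also have "\<dots> \<le> cmod (W p)"
    using \<open>cmod (g p) \<le> 1\<close> by (simp add: norm_mult mult_left_le_one_le)
  also have "\<dots> = (\<Prod>a\<in>A. cmod ((p - a) * U a p) ^ n a)"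
    by (simp add: W_def prod_norm[symmetric] norm_power)
  also have "\<dots> \<le> (\<Prod>a\<in>A. exp (- (\<kappa> / 2) * (1 - cmod a)) ^ n a)"
  proof (intro prod_mono conjI power_mono)
    fix a assume a: "a \<in> A"
    show "cmod ((p - a) * U a p) \<le> exp (- (\<kappa> / 2) * (1 - cmod a))"
      unfolding V q_def using norm_barrier_le[OF c Aa(1)[OF a] _ s _ _ \<eta>(1) x \<kappa> le] A(3)[OF a] p
      by (auto simp: orth_lune_def)
  qed auto
  also have "\<dots> = exp (\<Sum>a\<in>A. n a * (- (\<kappa> / 2) * (1 - cmod a)))"
    by (simp only: exp_sum[OF A(1)] exp_of_nat_mult)
  also have "(\<Sum>a\<in>A. n a * (- (\<kappa> / 2) * (1 - cmod a)))
      = - (\<kappa> / 2 * (\<Sum>a\<in>A. real_of_int (zorder f a) * (1 - cmod a)))"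
    unfolding sum_distrib_left sum_negf[symmetric] by (intro sum.cong) (auto simp: ord)
  finally have "exp (ln (cmod (f p)) - Re (K p)) \<le> exp (- (\<kappa> / 2 * (\<Sum>a\<in>A. real_of_int (zorder f a) * (1 - cmod a))))"
    using p by (simp add: exp_diff exp_minus field_simps)
  then show ?thesis by simp
qed

subsection \<open>Type of a closed subset of the circle\<close>

lemma norm_cis_minus_1: "cmod (cis a - 1) = 2 * \<bar>sin (a / 2)\<bar>"
  using dist_exp_i_1[of a] by (simp add: cis_conv_exp)

lemma dist_mult_cis:
  assumes "cmod s = 1"
  shows "dist s (s * cis a) = 2 * \<bar>sin (a / 2)\<bar>"
proof -
  have "dist s (s * cis a) = cmod (s * (cis a - 1))"
    by (simp add: dist_norm algebra_simps norm_minus_commute)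
  then show ?thesis
    by (simp add: norm_mult assms norm_cis_minus_1)
qed

lemma exists_rotation:
  assumes "cmod s = 1" "cmod e = 1"
  shows "\<exists>a. \<bar>a\<bar> \<le> pi \<and> e = s * cis a"
proof -
  have "cmod (e / s) = 1" "s \<noteq> 0"
    using assms by (auto simp: norm_divide)
  then have "cis (Arg (e / s)) = e / s"
    by (subst cis_Arg) (auto simp: sgn_eq)
  then have "e = s * cis (Arg (e / s))"
    using \<open>s \<noteq> 0\<close> by simp
  moreover have "\<bar>Arg (e / s)\<bar> \<le> pi"
    using Arg_bounded[of "e / s"] by linarith
  ultimately show ?thesis by blast
qed

lemma arc_dist_less_iff:
  assumes "cmod s = 1" "cmod e = 1"
  shows "arc_dist s e < x \<longleftrightarrow> (\<exists>a. \<bar>a\<bar> < x \<and> e = s * cis a)"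
  unfolding arc_dist_def using exists_rotation[OF assms]
  by (subst cInf_less_iff) (auto intro!: bdd_belowI[of _ 0])

lemma arc_dist_nonneg:
  assumes "cmod s = 1" "cmod e = 1"
  shows "arc_dist s e \<ge> 0"
  unfolding arc_dist_def using exists_rotation[OF assms] by (intro cInf_greatest) auto

text \<open>An arc of angle a \<le> \<pi> has chord 2 sin (a/2), and the sine increases on
  [0, \<pi>/2].\<close>

lemma arc_dist_less_iff_dist:
  assumes "cmod s = 1" "cmod e = 1" "0 < x" "x \<le> pi"
  shows "arc_dist s e < x \<longleftrightarrow> dist s e < 2 * sin (x / 2)"
proof
  assume "arc_dist s e < x"
  then obtain a where a: "\<bar>a\<bar> < x" "e = s * cis a"
    using arc_dist_less_iff[OF assms(1,2)] by blast
  have "\<bar>sin (a / 2)\<bar> = sin (\<bar>a\<bar> / 2)"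
    using a assms(4) sin_ge_zero[of "\<bar>a\<bar> / 2"] by (cases "a \<ge> 0") auto
  also have "\<dots> < sin (x / 2)"
    using a assms by (subst sin_mono_less_eq) auto
  finally show "dist s e < 2 * sin (x / 2)"
    using dist_mult_cis[OF assms(1), of a] a by simp
next
  assume less: "dist s e < 2 * sin (x / 2)"
  obtain a where a: "\<bar>a\<bar> \<le> pi" "e = s * cis a"
    using exists_rotation[OF assms(1,2)] by blast
  have "\<bar>sin (a / 2)\<bar> = sin (\<bar>a\<bar> / 2)"
    using a sin_ge_zero[of "\<bar>a\<bar> / 2"] by (cases "a \<ge> 0") auto
  then have "sin (\<bar>a\<bar> / 2) < sin (x / 2)"
    using less dist_mult_cis[OF assms(1), of a] a by simp
  then have "\<bar>a\<bar> < x"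
    using a assms by (subst (asm) sin_mono_less_eq) auto
  then show "arc_dist s e < x"
    using arc_dist_less_iff[OF assms(1,2)] a by blast
qed

lemma mem_arc_nbhd_iff:
  assumes "E \<subseteq> sphere 0 1" "E \<noteq> {}"
  shows "s \<in> arc_nbhd E x \<longleftrightarrow> cmod s = 1 \<and> (\<exists>e\<in>E. arc_dist s e < x)"
proof (cases "cmod s = 1")
  case True
  have "bdd_below (arc_dist s ` E)"
    using arc_dist_nonneg[OF True] assms by (intro bdd_belowI2[of _ 0]) auto
  then show ?thesis
    using assms(2) True by (auto simp: arc_nbhd_def cINF_less_iff)
qed (simp add: arc_nbhd_def)

text \<open>Arc neighbourhoods become traces of unions of Euclidean balls, which makes them Borel
  and comparable with chordal nets.\<close>

lemma arc_nbhd_eq_chord: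
  assumes "E \<subseteq> sphere 0 1" "E \<noteq> {}" "0 < x" "x \<le> pi"
  shows "arc_nbhd E x = sphere 0 1 \<inter> (\<Union>e\<in>E. ball e (2 * sin (x / 2)))"
proof (rule set_eqI)
  fix s
  show "s \<in> arc_nbhd E x \<longleftrightarrow> s \<in> sphere 0 1 \<inter> (\<Union>e\<in>E. ball e (2 * sin (x / 2)))"
    using arc_dist_less_iff_dist[of s _ x] assms
    by (auto simp: mem_arc_nbhd_iff[OF assms(1,2)] dist_commute subset_eq)
qed

lemma arc_nbhd_borel:
  assumes "E \<subseteq> sphere 0 1" "E \<noteq> {}" "0 < x" "x \<le> pi"
  shows "arc_nbhd E x \<in> sets borel"
  unfolding arc_nbhd_eq_chord[OF assms] by (intro sets.Int borel_closed borel_open open_UN) auto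

lemma arc_nbhd_mono:
  assumes "E \<subseteq> F" "F \<subseteq> sphere 0 1" "E \<noteq> {}"
  shows "arc_nbhd E x \<subseteq> arc_nbhd F x"
proof
  fix s assume "s \<in> arc_nbhd E x"
  then show "s \<in> arc_nbhd F x"
    using assms mem_arc_nbhd_iff[of E s x] mem_arc_nbhd_iff[of F s x] by auto
qed

section \<open>The normalized measure of the circle\<close>

lemma sets_circle_measure [simp]: "sets circle_measure = sets borel"
  by (simp add: circle_measure_def)

lemma measure_circle_measure:
  assumes "S \<in> sets borel"
  shows "measure circle_measure S = measure lborel ({0..<2 * pi} \<inter> cis -` S) / (2 * pi)"
proof -
  have cis: "cis \<in> borel \<rightarrow>\<^sub>M borel"
    by (intro borel_measurable_continuous_onI continuous_intros)
  then have "cis -` S \<in> sets borel"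
    using measurable_sets[OF cis assms] by simp
  moreover have "measure circle_measure S = measure (uniform_measure lborel {0..<2 * pi}) (cis -` S)"
    unfolding circle_measure_def using cis assms by (subst measure_distr) auto
  ultimately show ?thesis
    by (simp add: measure_uniform_measure)
qed

lemma finite_measure_circle_measure: "finite_measure circle_measure"
proof (rule finite_measureI)
  have "emeasure circle_measure (space circle_measure) = emeasure (uniform_measure lborel {0..<2 * pi}) UNIV"
    unfolding circle_measure_def using borel_measurable_continuous_onI[OF continuous_on_cis[OF continuous_on_id]]
    by (subst emeasure_distr) auto
  also have "\<dots> = 1"
    by (subst emeasure_uniform_measure) (auto simp: divide_ennreal ennreal_1[symmetric] simp del: ennreal_1)
  finally show "emeasure circle_measure (space circle_measure) \<noteq> \<infinity>"
    by simp
qed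

lemma measure_circle_measure_le_1: "measure circle_measure S \<le> 1"
proof (cases "S \<in> sets borel")
  case True
  have "measure lborel ({0..<2 * pi} \<inter> cis -` S) \<le> measure lborel {0..<2 * pi}"
    using measurable_sets[OF _ True, of cis borel]
    by (intro measure_mono_fmeasurable)
       (auto simp: borel_measurable_continuous_onI continuous_on_cis continuous_on_id fmeasurable_def)
  then show ?thesis
    unfolding measure_circle_measure[OF True] by simp
next
  case False
  then have "measure circle_measure S = 0"
    by (simp add: measure_notin_sets)
  then show ?thesis by simp
qed

text \<open>Chords are no longer than arcs, so r radians on one side of e already lie in the cap.
  The side is chosen so that the angles stay in [0, 2 \<pi>) without wrapping around.\<close>

lemma measure_cap_ge:
  assumes "cmod e = 1" "0 < r" "r \<le> 1"
  shows "measure circle_measure (sphere 0 1 \<inter> ball e r) \<ge> r / (2 * pi)"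
proof -
  let ?S = "sphere 0 1 \<inter> ball e r"
  obtain \<theta> where \<theta>: "0 \<le> \<theta>" "\<theta> < 2 * pi" "e = cis \<theta>"
    using that[of "Arg2pi e"] complex_norm_eq_1_exp[of e] Arg2pi[of e] assms(1) by (simp add: cis_conv_exp)
  define l where "l = (if \<theta> + r \<le> 2 * pi then \<theta> else \<theta> - r)"
  have l: "0 \<le> l" "l + r \<le> 2 * pi"
    using \<theta> assms pi_gt3 by (auto simp: l_def)
  have sub: "{l<..<l + r} \<subseteq> {0..<2 * pi} \<inter> cis -` ?S"
  proof
    fix u assume u: "u \<in> {l<..<l + r}"
    have "cis u = e * cis (u - \<theta>)"
      by (simp add: \<theta> cis_mult)
    then have "dist e (cis u) = 2 * \<bar>sin ((u - \<theta>) / 2)\<bar>"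
      using dist_mult_cis[OF assms(1)] by simp
    also have "\<dots> \<le> \<bar>u - \<theta>\<bar>"
      using abs_sin_x_le_abs_x[of "(u - \<theta>) / 2"] by simp
    also have "\<dots> < r"
      using u by (auto simp: l_def split: if_splits)
    finally show "u \<in> {0..<2 * pi} \<inter> cis -` ?S"
      using l u by auto
  qed
  have S: "?S \<in> sets borel"
    by (intro sets.Int borel_closed borel_open) auto
  have "cis -` ?S \<in> sets borel"
    using measurable_sets[OF _ S, of cis borel] by (simp add: borel_measurable_continuous_onI continuous_on_cis continuous_on_id)
  then have "{0..<2 * pi} \<inter> cis -` ?S \<in> fmeasurable lborel"
    by - (rule fmeasurableI2[of "{0..<2 * pi}"], auto simp: fmeasurable_def)
  then have "measure lborel {l<..<l + r} \<le> measure lborel ({0..<2 * pi} \<inter> cis -` ?S)"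
    by (intro measure_mono_fmeasurable[OF sub]) simp_all
  moreover have "measure lborel {l<..<l + r} = r"
    using assms by simp
  ultimately have "r \<le> measure lborel ({0..<2 * pi} \<inter> cis -` ?S)"
    by simp
  then show ?thesis
    unfolding measure_circle_measure[OF S] by (intro divide_right_mono) auto
qed

section \<open>Separated sets and nets\<close>

text \<open>The caps of radius r/2 around the points are disjoint, lie in the r-neighbourhood of E,
  and each has measure at least r/(4 \<pi>).\<close>

lemma card_separated_le:
  fixes r :: real
  assumes E: "E \<subseteq> sphere 0 1" and F: "finite F" "F \<subseteq> E" "F \<noteq> {}"
    and sep: "\<And>y z. y \<in> F \<Longrightarrow> z \<in> F \<Longrightarrow> y \<noteq> z \<Longrightarrow> dist y z \<ge> r" and r: "0 < r" "r \<le> 1"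
  shows "card F * r \<le> 4 * pi * measure circle_measure (arc_nbhd E r)"
proof -
  interpret finite_measure circle_measure by (rule finite_measure_circle_measure)
  let ?S = "\<lambda>e. sphere 0 1 \<inter> ball e (r / 2) :: complex set"
  have S: "?S e \<in> sets borel" for e
    by (intro sets.Int borel_closed borel_open) auto
  have "?S e \<subseteq> arc_nbhd E r" if "e \<in> F" for e
  proof -
    \<comment> \<open>The arc neighbourhood has chordal radius 2 sin (r/2) < r, so the caps must be
      shown to fit; the cosine is at least 1/2 on the short interval concerned.\<close>
    have "r / 2 \<le> 2 * sin (r / 2)"
    proof -
      obtain z where z: "0 < z" "z < r / 2" "sin (r / 2) - sin 0 = (r / 2 - 0) * cos z"
        using MVT2[of 0 "r / 2" sin cos] r by (auto intro!: derivative_eq_intros)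
      have "cos (pi / 3) \<le> cos z"
        using z r pi_gt3 by (intro cos_monotone_0_pi_le) auto
      then have "r / 2 * (1/2) \<le> r / 2 * cos z"
        using r by (intro mult_left_mono) (simp_all add: cos_60)
      then show ?thesis
        using z(3) by simp
    qed
    moreover have "arc_nbhd E r = sphere 0 1 \<inter> (\<Union>e\<in>E. ball e (2 * sin (r / 2)))"
      using F E r pi_gt3 by (intro arc_nbhd_eq_chord) auto
    ultimately show ?thesis
      using that F by fastforce
  qed
  moreover have "disjoint_family_on ?S F"
    unfolding disjoint_family_on_def
  proof (intro ballI impI)
    fix y z assume "y \<in> F" "z \<in> F" "y \<noteq> z"
    then have "ball y (r/2) \<inter> ball z (r/2) = {}"
      using sep[of y z] disjoint_ballI[of "r/2" "r/2" y z] by simp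
    then show "?S y \<inter> ?S z = {}" by blast
  qed
  moreover have "arc_nbhd E r \<in> sets borel"
    using F E r pi_gt3 by (intro arc_nbhd_borel) auto
  ultimately have "(\<Sum>e\<in>F. measure circle_measure (?S e)) \<le> measure circle_measure (arc_nbhd E r)"
    using F S
    by (subst finite_measure_finite_Union[symmetric]) (auto intro!: finite_measure_mono)
  moreover have "(\<Sum>e\<in>F. (r / 2) / (2 * pi)) \<le> (\<Sum>e\<in>F. measure circle_measure (?S e))"
    using F E r by (intro sum_mono measure_cap_ge) auto
  ultimately have "card F * ((r / 2) / (2 * pi)) \<le> measure circle_measure (arc_nbhd E r)"
    by simp
  then show ?thesis
    by (simp add: field_simps)
qed

text \<open>An r-separated subset of maximal cardinality is an r-net, since any uncovered point
  could be added. The packing bound makes the cardinalities bounded and also gives the final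
  estimate.\<close>

lemma exists_net:
  fixes r :: real
  assumes E: "E \<subseteq> sphere 0 1" "E \<noteq> {}" and r: "0 < r" "r \<le> 1"
  shows "\<exists>F. finite F \<and> F \<subseteq> E \<and> (\<forall>e\<in>E. \<exists>y\<in>F. dist e y < r) \<and>
    card F * r \<le> 4 * pi * measure circle_measure (arc_nbhd E r)"
proof -
  define P where "P = (\<lambda>F. finite F \<and> F \<subseteq> E \<and> F \<noteq> {} \<and> (\<forall>y\<in>F. \<forall>z\<in>F. y \<noteq> z \<longrightarrow> dist y z \<ge> r))"
  have card: "card F * r \<le> 4 * pi * measure circle_measure (arc_nbhd E r)" if "P F" for F
    using that E r by (intro card_separated_le) (auto simp: P_def)
  have "card F \<le> nat \<lceil>4 * pi / r\<rceil>" if "P F" for F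
  proof -
    have "card F * r \<le> 4 * pi * 1"
      using card[OF that] measure_circle_measure_le_1[of "arc_nbhd E r"] mult_left_mono[of _ 1 "4 * pi"] pi_gt_zero
      by (meson less_eq_real_def mult_nonneg_nonneg order_trans zero_le_numeral)
    then have "card F \<le> 4 * pi / r"
      using r by (simp add: field_simps)
    then show ?thesis by linarith
  qed
  moreover obtain e where "e \<in> E"
    using E by blast
  then have "P {e}"
    by (auto simp: P_def)
  ultimately obtain F where F: "P F" and max: "\<And>F'. P F' \<Longrightarrow> card F' \<le> card F"
    using ex_has_greatest_nat[of P "{e}" card "Suc (nat \<lceil>4 * pi / r\<rceil>)"] by (auto simp: less_Suc_eq_le)
  have "\<exists>y\<in>F. dist e y < r" if "e \<in> E" for e
  proof (rule ccontr)
    assume neg: "\<not> (\<exists>y\<in>F. dist e y < r)"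
    then have "P (insert e F)"
      using F that by (auto simp: P_def dist_commute not_less)
    moreover have "e \<notin> F"
      using neg r by auto
    ultimately show False
      using max[of "insert e F"] F by (simp add: P_def)
  qed
  then show ?thesis
    using F card[OF F] by (auto simp: P_def)
qed

section \<open>Range and monotonicity of the type\<close>

text \<open>A single point of E forces the x-neighbourhood to have measure at least x/(4 \<pi>),
  which is not O(x^b) when b > 1.\<close>

lemma set_type_exponent_le_1:
  assumes E: "E \<subseteq> sphere 0 1" "E \<noteq> {}"
    and b: "(\<lambda>x. measure circle_measure (arc_nbhd E x)) \<in> O[at_right 0](\<lambda>x. x powr b)"
  shows "b \<le> 1"
proof (rule ccontr)
  assume "\<not> b \<le> 1"
  obtain c where c: "c > 0"
    and ev: "eventually (\<lambda>x. norm (measure circle_measure (arc_nbhd E x)) \<le> c * norm (x powr b)) (at_right 0)"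
    using b by (elim landau_o.bigE)
  obtain e where e: "e \<in> E"
    using E by blast
  have "eventually (\<lambda>x. 1 \<le> 4 * pi * c * x powr (b - 1)) (at_right 0)"
    using ev eventually_at_right_real[OF zero_less_one]
  proof eventually_elim
    case (elim x)
    have "x \<le> 4 * pi * measure circle_measure (arc_nbhd E x)"
      using card_separated_le[OF E(1), of "{e}" x] e elim by simp
    also have "\<dots> \<le> 4 * pi * (c * x powr b)"
      using elim by (intro mult_left_mono) auto
    also have "x powr b = x * x powr (b - 1)"
      using elim by (simp add: powr_diff)
    finally have "x * 1 \<le> x * (4 * pi * c * x powr (b - 1))"
      by (simp add: mult_ac)
    moreover have "x > 0"
      using elim by simp
    ultimately show ?case
      by (simp only: mult_le_cancel_left_pos)
  qed
  moreover have "((\<lambda>x. 4 * pi * c * x powr (b - 1)) \<longlongrightarrow> 4 * pi * c * 0) (at_right 0)"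
    using \<open>\<not> b \<le> 1\<close> by (intro tendsto_mult_left tendsto_zero_powrI) (auto intro!: tendsto_intros eventually_at_rightI[of 0 1])
  ultimately show False
    using tendsto_lowerbound[of "\<lambda>x. 4 * pi * c * x powr (b - 1)" "4 * pi * c * 0" "at_right 0" 1] by simp
qed

lemma set_type_exponents_nonempty:
  "0 \<in> {b. (\<lambda>x. measure circle_measure (arc_nbhd E x)) \<in> O[at_right 0](\<lambda>x. x powr b)}"
proof -
  have "eventually (\<lambda>x. norm (measure circle_measure (arc_nbhd E x)) \<le> 1 * norm (x powr 0)) (at_right 0)"
    using eventually_at_right_real[OF zero_less_one]
    by (rule eventually_mono) (auto simp: measure_circle_measure_le_1)
  then show ?thesis
    by (auto intro: landau_o.bigI[of 1])
qed

lemma bdd_above_set_type_exponents: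
  assumes "E \<subseteq> sphere 0 1" "E \<noteq> {}"
  shows "bdd_above {b. (\<lambda>x. measure circle_measure (arc_nbhd E x)) \<in> O[at_right 0](\<lambda>x. x powr b)}"
  using set_type_exponent_le_1[OF assms] by (intro bdd_aboveI[of _ 1]) auto

lemma set_type_le_1:
  assumes "E \<subseteq> sphere 0 1" "E \<noteq> {}"
  shows "set_type E \<le> 1"
  unfolding set_type_def using set_type_exponents_nonempty set_type_exponent_le_1[OF assms]
  by (intro cSup_least) blast+

lemma set_type_antimono:
  assumes "E \<subseteq> F" "F \<subseteq> sphere 0 1" "E \<noteq> {}"
  shows "set_type F \<le> set_type E"
  unfolding set_type_def
proof (rule cSup_subset_mono)
  show "{b. (\<lambda>x. measure circle_measure (arc_nbhd F x)) \<in> O[at_right 0](\<lambda>x. x powr b)} \<noteq> {}"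
    using set_type_exponents_nonempty by blast
  show "bdd_above {b. (\<lambda>x. measure circle_measure (arc_nbhd E x)) \<in> O[at_right 0](\<lambda>x. x powr b)}"
    using assms by (intro bdd_above_set_type_exponents) auto
  have "eventually (\<lambda>x. norm (measure circle_measure (arc_nbhd E x)) \<le> norm (measure circle_measure (arc_nbhd F x))) (at_right 0)"
    using eventually_at_right_real[OF zero_less_one]
  proof eventually_elim
    case (elim x)
    interpret finite_measure circle_measure by (rule finite_measure_circle_measure)
    have "arc_nbhd F x \<in> sets borel"
      using elim assms pi_gt3 by (intro arc_nbhd_borel) auto
    then show ?case
      using arc_nbhd_mono[OF assms] by (auto intro!: finite_measure_mono)
  qed
  then have "(\<lambda>x. measure circle_measure (arc_nbhd E x)) \<in> O[at_right 0](\<lambda>x. measure circle_measure (arc_nbhd F x))"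
    by (intro landau_o.bigI[of 1]) auto
  then show "{b. (\<lambda>x. measure circle_measure (arc_nbhd F x)) \<in> O[at_right 0](\<lambda>x. x powr b)}
    \<subseteq> {b. (\<lambda>x. measure circle_measure (arc_nbhd E x)) \<in> O[at_right 0](\<lambda>x. x powr b)}"
    using landau_o.big_trans by blast
qed

section \<open>The local type\<close>

text \<open>The type grows as the radius shrinks and is at most 1, so the one-sided limit exists and
  is the supremum over all radii.\<close>

lemma local_type_tendsto:
  assumes "E \<subseteq> sphere 0 1" "t \<in> E"
  shows "((\<lambda>r. set_type (E \<inter> cball t r)) \<longlongrightarrow> local_type E t) (at_right 0)"
proof -
  let ?g = "\<lambda>r. set_type (E \<inter> cball t r)"
  have bdd: "bdd_above (?g ` {0<..})"
    using assms by (intro bdd_aboveI2[of _ _ 1] set_type_le_1) auto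
  have mono: "?g r \<le> ?g r'" if "0 < r'" "r' \<le> r" for r r'
    using that assms by (intro set_type_antimono) auto
  have "(?g \<longlongrightarrow> Sup (?g ` {0<..})) (at_right 0)"
  proof (rule order_tendstoI)
    fix l assume "l < Sup (?g ` {0<..})"
    then obtain r where r: "r > 0" "l < ?g r"
      using less_cSup_iff[OF _ bdd] by auto
    then show "eventually (\<lambda>r. l < ?g r) (at_right 0)"
      using mono by (intro eventually_at_rightI[of 0 r]) (auto intro: less_le_trans)
  next
    fix l assume "Sup (?g ` {0<..}) < l"
    then show "eventually (\<lambda>r. ?g r < l) (at_right 0)"
      using cSUP_upper[OF _ bdd] by (intro eventually_at_rightI[of 0 1]) (auto intro: le_less_trans)
  qed
  then show ?thesis
    unfolding local_type_def using tendsto_Lim[of "at_right (0::real)" ?g] by simp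
qed

lemma local_type_measure_bound:
  assumes E: "E \<subseteq> sphere 0 1" "t \<in> E" and "\<epsilon> > 0"
  shows "\<exists>r b C. 0 < r \<and> r \<le> 1 \<and> local_type E t - \<epsilon> < b \<and> C > 0 \<and>
    (\<forall>x. 0 < x \<longrightarrow> x \<le> 1 \<longrightarrow> measure circle_measure (arc_nbhd (E \<inter> cball t r) x) \<le> C * x powr b)"
proof -
  have "eventually (\<lambda>r. local_type E t - \<epsilon> < set_type (E \<inter> cball t r)) (at_right 0)"
    using order_tendstoD(1)[OF local_type_tendsto[OF E]] \<open>\<epsilon> > 0\<close> by simp
  then have "eventually (\<lambda>r. local_type E t - \<epsilon> < set_type (E \<inter> cball t r) \<and> 0 < r \<and> r < 1) (at_right 0)"
    using eventually_at_right_real[OF zero_less_one] by eventually_elim auto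
  from eventually_happens'[OF trivial_limit_at_right_real this]
  obtain r where r: "0 < r" "r < 1" "local_type E t - \<epsilon> < set_type (E \<inter> cball t r)"
    by blast
  let ?m = "\<lambda>x. measure circle_measure (arc_nbhd (E \<inter> cball t r) x)"
  obtain b where b: "local_type E t - \<epsilon> < b" "?m \<in> O[at_right 0](\<lambda>x. x powr b)"
  proof (rule less_cSupE[OF r(3)[unfolded set_type_def]])
    show "{b. ?m \<in> O[at_right 0](\<lambda>x. x powr b)} \<noteq> {}"
      using set_type_exponents_nonempty by blast
  qed (use that in blast)
  obtain c where c: "c > 0" and "eventually (\<lambda>x. norm (?m x) \<le> c * norm (x powr b)) (at_right 0)"
    using b(2) by (elim landau_o.bigE)
  then obtain x0 where x0: "x0 > 0" "\<And>x. 0 < x \<Longrightarrow> x < x0 \<Longrightarrow> ?m x \<le> c * x powr b"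
    unfolding eventually_at_right_field by auto
  \<comment> \<open>The O-bound holds only for x < x0. For larger x the measure is at most 1, while
    x^b is at least min 1 (x0^b) whatever the sign of b.\<close>
  define C where "C = max c (1 / min 1 (x0 powr b))"
  have "?m x \<le> C * x powr b" if x: "0 < x" "x \<le> 1" for x
  proof (cases "x < x0")
    case True
    have "c * x powr b \<le> C * x powr b"
      by (intro mult_right_mono) (auto simp: C_def)
    then show ?thesis
      using x0(2)[OF x(1) True] by linarith
  next
    case False
    have "min 1 (x0 powr b) \<le> x powr b"
    proof (cases "b \<ge> 0")
      case True
      then show ?thesis
        using False x0(1) powr_mono2[of b x0 x] by auto
    next
      case False
      then have "1 \<le> x powr b"
        using x powr_mono'[of b 0 x] by simp
      then show ?thesis by simp
    qed
    moreover have "min 1 (x0 powr b) > 0"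
      using x0(1) by simp
    ultimately have "1 \<le> 1 / min 1 (x0 powr b) * x powr b"
      by (simp add: pos_le_divide_eq)
    also have "\<dots> \<le> C * x powr b"
      by (intro mult_right_mono) (auto simp: C_def)
    finally show ?thesis
      using measure_circle_measure_le_1 order_trans by blast
  qed
  moreover have "C > 0"
    using c by (simp add: C_def)
  ultimately show ?thesis
    using r b(1) by (intro exI[of _ r] exI[of _ b] exI[of _ C]) auto
qed

subsection \<open>Dyadic summation\<close>

lemma dyadic_index:
  fixes d :: real
  assumes "0 < d" "d \<le> 1"
  shows "\<exists>k. (1/2) ^ k \<le> d \<and> d \<le> 2 * (1/2) ^ k"
proof -
  obtain n where "(1/2) ^ n < d"
    using real_arch_pow_inv[OF assms(1), of "1/2"] by auto
  then have ex: "\<exists>n. (1/2) ^ n \<le> d"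
    by (auto intro: less_imp_le)
  define k where "k = (LEAST n. (1/2) ^ n \<le> d)"
  have "(1/2) ^ k \<le> d"
    unfolding k_def using ex by (rule LeastI_ex)
  moreover have "d \<le> 2 * (1/2) ^ k"
  proof (cases k)
    case 0
    then show ?thesis using assms by simp
  next
    case (Suc i)
    then have "\<not> (1/2) ^ i \<le> d"
      using not_less_Least[of i "\<lambda>n. (1/2) ^ n \<le> d"] by (simp add: k_def)
    then show ?thesis
      by (simp add: Suc)
  qed
  ultimately show ?thesis by blast
qed

lemma sum_geometric_le:
  fixes x :: real
  assumes "0 \<le> x" "x < 1"
  shows "(\<Sum>j\<le>n. x ^ j) \<le> 1 / (1 - x)"
proof -
  have "(\<Sum>j\<le>n. x ^ j) = (1 - x ^ Suc n) / (1 - x)"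
    using assms by (simp add: sum_gp0)
  also have "\<dots> \<le> 1 / (1 - x)"
    using assms by (intro divide_right_mono) auto
  finally show ?thesis .
qed

lemma sum_geometric_growth_le:
  fixes y :: real
  assumes "y > 1"
  shows "(\<Sum>j\<le>n. y ^ j) \<le> y / (y - 1) * y ^ n"
proof -
  have "(\<Sum>j\<le>n. y ^ j) = (y ^ Suc n - 1) / (y - 1)"
    using assms by (simp add: sum_gp0 field_simps)
  also have "\<dots> \<le> y ^ Suc n / (y - 1)"
    using assms by (intro divide_right_mono) auto
  finally show ?thesis by simp
qed

text \<open>If q = 0, then s < 0 and the geometric sums are bounded. If q > 0, the mass of d \<ge>
  2^-n is O(2^(\<kappa> n)) for some \<kappa> < q, so the layer where d is about 2^-n contributes
  O(2^((\<kappa> - q) n)). The shift \<open>M\<close> only changes constants.\<close>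

lemma dyadic_growth_imp_weighted_summable:
  fixes m d :: "'a \<Rightarrow> real"
  assumes q: "q \<ge> 0" "s < q" and md: "\<And>a. a \<in> Z \<Longrightarrow> 0 \<le> m a \<and> 0 < d a \<and> d a \<le> 1"
    and C: "C \<ge> 0"
    and bound: "\<And>A k. finite A \<Longrightarrow> A \<subseteq> Z \<Longrightarrow> (\<And>a. a \<in> A \<Longrightarrow> d a \<ge> (1/2) ^ k) \<Longrightarrow>
      sum m A \<le> C * (1 + (\<Sum>j\<le>k + M. (2 powr s) ^ j))"
  shows "(\<lambda>a. m a * d a powr q) summable_on Z"
proof -
  have ex: "\<forall>a. \<exists>k. a \<in> Z \<longrightarrow> (1/2) ^ k \<le> d a \<and> d a \<le> 2 * (1/2) ^ k"
    using dyadic_index md by blast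
  then obtain k where k: "\<And>a. a \<in> Z \<Longrightarrow> (1/2) ^ k a \<le> d a \<and> d a \<le> 2 * (1/2) ^ k a"
    by metis
  have "\<exists>B. \<forall>A. finite A \<longrightarrow> A \<subseteq> Z \<longrightarrow> (\<Sum>a\<in>A. m a * d a powr q) \<le> B"
  proof (cases "q = 0")
    case True
    then have "2 powr s < 1"
      using q powr_less_mono[of s 0 2] by simp
    have "(\<Sum>a\<in>A. m a * d a powr q) \<le> C * (1 + 1 / (1 - 2 powr s))" if A: "finite A" "A \<subseteq> Z" for A
    proof -
      define N where "N = Max (insert 0 (k ` A))"
      have "(1/2) ^ N \<le> d a" if "a \<in> A" for a
      proof -
        have "k a \<le> N"
          unfolding N_def using A that by (intro Max_ge) auto
        then have "(1/2) ^ N \<le> (1/2 :: real) ^ k a"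
          by (intro power_decreasing) auto
        also have "\<dots> \<le> d a"
          using k[of a] A that by blast
        finally show ?thesis .
      qed
      then have "sum m A \<le> C * (1 + (\<Sum>j\<le>N + M. (2 powr s) ^ j))"
        using A by (intro bound) auto
      also have "\<dots> \<le> C * (1 + 1 / (1 - 2 powr s))"
        using sum_geometric_le[of "2 powr s" "N + M"] \<open>2 powr s < 1\<close> C
        by (intro mult_left_mono add_left_mono) auto
      also have "sum m A = (\<Sum>a\<in>A. m a * d a powr q)"
      proof (rule sum.cong)
        fix a assume "a \<in> A"
        then have "d a > 0"
          using A md by auto
        then show "m a = m a * d a powr q"
          by (simp add: True)
      qed simp
      finally show ?thesis .
    qed
    then show ?thesis by blast
  next
    case False
    \<comment> \<open>Chosen to be at least s, below q and strictly positive, so that the geometric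
      sums grow like their last term even when s \<le> 0.\<close>
    define \<kappa> where "\<kappa> = max ((q + s) / 2) (q / 2)"
    have \<kappa>: "\<kappa> > 0" "\<kappa> < q"
      using q False by (auto simp: \<kappa>_def)
    have "s \<le> \<kappa>"
      unfolding \<kappa>_def using q by (intro max.coboundedI1) simp
    define y where "y = 2 powr \<kappa>"
    define z where "z = 2 powr (\<kappa> - q)"
    have y: "y > 1"
      using \<kappa> by (simp add: y_def)
    have z: "0 < z" "z < 1"
      using \<kappa> powr_less_mono[of "\<kappa> - q" 0 2] by (simp_all add: z_def)
    define D where "D = C * (1 + y / (y - 1) * y ^ M)"
    have layer: "sum m A \<le> D * y ^ n" if A: "finite A" "A \<subseteq> Z" "\<And>a. a \<in> A \<Longrightarrow> d a \<ge> (1/2) ^ n" for A n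
    proof -
      have "sum m A \<le> C * (1 + (\<Sum>j\<le>n + M. (2 powr s) ^ j))"
        using A by (intro bound) auto
      also have "\<dots> \<le> C * (1 + (\<Sum>j\<le>n + M. y ^ j))"
        using C \<open>s \<le> \<kappa>\<close> by (intro mult_left_mono add_left_mono sum_mono power_mono) (auto simp: y_def)
      also have "\<dots> \<le> C * (y ^ n + y / (y - 1) * y ^ (n + M))"
        using C y by (intro mult_left_mono add_mono sum_geometric_growth_le) auto
      also have "\<dots> = D * y ^ n"
        by (simp add: D_def power_add algebra_simps)
      finally show ?thesis .
    qed
    have "D \<ge> 0"
      using C y by (simp add: D_def)
    have "(\<Sum>a\<in>A. m a * d a powr q) \<le> D * 2 powr q * (1 / (1 - z))" if A: "finite A" "A \<subseteq> Z" for A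
    proof -
      define N where "N = Max (insert 0 (k ` A))"
      have "(\<Sum>a\<in>A. m a * d a powr q) = (\<Sum>n\<le>N. \<Sum>a\<in>{a \<in> A. k a = n}. m a * d a powr q)"
        using A by (intro sum.group[symmetric]) (auto simp: N_def intro!: Max_ge)
      also have "\<dots> \<le> (\<Sum>n\<le>N. D * 2 powr q * z ^ n)"
      proof (rule sum_mono)
        fix n
        let ?A = "{a \<in> A. k a = n}"
        have "(\<Sum>a\<in>?A. m a * d a powr q) \<le> (\<Sum>a\<in>?A. m a * (2 * (1/2) ^ n) powr q)"
          using A k md q by (intro sum_mono mult_left_mono powr_mono2) (auto simp: subset_eq less_imp_le)
        also have "\<dots> = sum m ?A * (2 * (1/2) ^ n) powr q"
          by (simp add: sum_distrib_right)
        also have "\<dots> \<le> D * y ^ n * (2 * (1/2) ^ n) powr q"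
          using A k by (intro mult_right_mono layer) auto
        also have "(2 * (1/2) ^ n) powr q = 2 powr q * (2 powr (- q)) ^ n"
          by (simp add: powr_mult powr_power powr_realpow[symmetric] powr_minus powr_powr power_one_over powr_divide inverse_eq_divide mult.commute)
        also have "D * y ^ n * (2 powr q * (2 powr (- q)) ^ n) = D * 2 powr q * (y * 2 powr (- q)) ^ n"
          by (simp add: power_mult_distrib)
        also have "y * 2 powr (- q) = z"
          by (simp add: y_def z_def powr_add[symmetric])
        finally show "(\<Sum>a\<in>?A. m a * d a powr q) \<le> D * 2 powr q * z ^ n" .
      qed
      also have "\<dots> \<le> D * 2 powr q * (1 / (1 - z))"
        unfolding sum_distrib_left[symmetric] using z \<open>D \<ge> 0\<close>
        by (intro mult_left_mono sum_geometric_le) auto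
      finally show ?thesis .
    qed
    then show ?thesis by blast
  qed
  then obtain B where "\<And>A. finite A \<Longrightarrow> A \<subseteq> Z \<Longrightarrow> (\<Sum>a\<in>A. m a * d a powr q) \<le> B"
    by blast
  then show ?thesis
    using md by (intro nonneg_bdd_above_summable_on) (auto intro!: bdd_aboveI2[of _ _ B])
qed

subsection \<open>Majorants of powers of the distance\<close>

text \<open>With \<open>F j\<close> a net of \<open>E\<close> at scale \<open>2\<^sup>-\<^sup>j\<close>, the real part is a positive harmonic function
  dominating \<open>d(w,E)\<^sup>-\<^sup>\<rho>\<close> wherever \<open>d(w,E) > 2\<^sup>-\<^sup>J\<close>.\<close>
definition pole_majorant :: "(nat \<Rightarrow> complex set) \<Rightarrow> real \<Rightarrow> nat \<Rightarrow> complex \<Rightarrow> complex" where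
  "pole_majorant F \<rho> J w = (\<Sum>j\<le>J. of_real (9 * 2 powr \<rho> * (2 powr \<rho>) ^ j * (1/2) ^ j) *
     (\<Sum>e\<in>F j. outer_pole e ((1/2) ^ j) w))"

lemma Re_pole_majorant:
  "Re (pole_majorant F \<rho> J w) = (\<Sum>j\<le>J. 9 * 2 powr \<rho> * (2 powr \<rho>) ^ j * (1/2) ^ j *
     (\<Sum>e\<in>F j. Re (outer_pole e ((1/2) ^ j) w)))"
proof -
  have "Re (of_real c * z) = c * Re z" for c z
    by simp
  then show ?thesis
    unfolding pole_majorant_def by (simp only: Re_sum)
qed

lemma holomorphic_pole_majorant:
  assumes "\<And>j. F j \<subseteq> sphere 0 1"
  shows "pole_majorant F \<rho> J holomorphic_on ball 0 1"
proof -
  have "of_real (1 + (1/2) ^ j) * e - w \<noteq> 0" if "e \<in> F j" "w \<in> ball 0 1" for j e w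
    using that assms[of j] by (intro outer_pole_denominator_nz) auto
  then show ?thesis
    unfolding pole_majorant_def outer_pole_def by (intro holomorphic_intros)
qed

text \<open>One term suffices, the others being nonnegative: take r = 2^-j with d between r/2 and r.
  A net point within r of e puts a pole within 3 r of w, whose real part is at least 1/(9 r); the
  coefficient turns this into 2^(\<rho> (j + 1)).\<close>

lemma pole_majorant_ge:
  assumes F: "\<And>j. finite (F j)" "\<And>j. F j \<subseteq> sphere 0 1"
    and net: "\<And>j. \<exists>y\<in>F j. dist e y < (1/2) ^ j"
    and w: "cmod w < 1" and d: "(1/2) ^ J < dist w e" "dist w e \<le> 1" and \<rho>: "\<rho> \<ge> 0"
  shows "1 / dist w e powr \<rho> \<le> Re (pole_majorant F \<rho> J w)"
proof -
  define d where "d = dist w e"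
  have "d > 0" "d \<le> 1"
    using d by (auto simp: d_def intro: less_trans[rotated])
  obtain i where i: "(1/2) ^ i \<le> d" "d \<le> 2 * (1/2) ^ i"
    using dyadic_index[OF \<open>d > 0\<close> \<open>d \<le> 1\<close>] by blast
  \<comment> \<open>Passing from i to its predecessor turns d \<le> 2 * 2^-i into d \<le> 2^-j. For
    i = 0 the truncated subtraction gives j = 0, which is right because then d = 1.\<close>
  define j where "j = i - 1"
  have j: "(1/2) ^ Suc j \<le> d" "d \<le> (1/2) ^ j"
    using i \<open>d \<le> 1\<close> by (auto simp: j_def) (cases i; simp)+
  have "j \<le> J"
  proof (rule ccontr)
    assume "\<not> j \<le> J"
    then have "(1/2 :: real) ^ j \<le> (1/2) ^ J"
      by (intro power_decreasing) auto
    with j(2) have "d \<le> (1/2) ^ J"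
      by (rule order_trans)
    then show False
      using d(1) unfolding d_def by linarith
  qed
  obtain y where y: "y \<in> F j" "dist e y < (1/2) ^ j"
    using net by blast
  define r :: real where "r = (1/2) ^ j"
  have "r > 0" by (simp add: r_def)
  have y1: "cmod y = 1"
    using y F(2)[of j] by auto
  have nn: "Re (outer_pole e ((1/2) ^ j) w) \<ge> 0" if "e \<in> F j" for j e
    using that F(2)[of j] w by (intro Re_outer_pole_nonneg) auto
  have "cmod (of_real (1 + r) * y - w) \<le> 3 * r"
  proof -
    have "cmod (of_real (1 + r) * y - w) = cmod (of_real r * y + (y - w))"
      by (simp add: algebra_simps)
    also have "\<dots> \<le> cmod (of_real r * y) + cmod (y - w)"
      by (rule norm_triangle_ineq)
    also have "cmod (of_real r * y) = r"
      using \<open>r > 0\<close> y1 by (simp add: norm_mult)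
    also have "cmod (y - w) \<le> dist y e + dist e w"
      using dist_triangle[of y w e] by (simp add: dist_norm)
    finally show ?thesis
      using y j by (simp add: r_def d_def dist_commute)
  qed
  then have "r / (3 * r)\<^sup>2 \<le> r / (cmod (of_real (1 + r) * y - w))\<^sup>2"
    using outer_pole_denominator_nz[OF y1 \<open>r > 0\<close>, of w] w \<open>r > 0\<close>
    by (intro divide_left_mono power_mono) (auto simp del: of_real_add)
  also have "\<dots> \<le> Re (outer_pole y r w)"
    using w by (intro Re_outer_pole_ge y1 \<open>r > 0\<close>) auto
  also have "\<dots> \<le> (\<Sum>e\<in>F j. Re (outer_pole e r w))"
    using y F(1) nn[of _ j] unfolding r_def by (intro member_le_sum) auto
  finally have "9 * 2 powr \<rho> * (2 powr \<rho>) ^ j * r * (r / (3 * r)\<^sup>2)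
      \<le> 9 * 2 powr \<rho> * (2 powr \<rho>) ^ j * r * (\<Sum>e\<in>F j. Re (outer_pole e r w))"
    using \<open>r > 0\<close> by (intro mult_left_mono) auto
  also have "9 * 2 powr \<rho> * (2 powr \<rho>) ^ j * r * (r / (3 * r)\<^sup>2) = (2 powr \<rho>) ^ Suc j"
    using \<open>r > 0\<close> by (simp add: power2_eq_square)
  also have "9 * 2 powr \<rho> * (2 powr \<rho>) ^ j * r * (\<Sum>e\<in>F j. Re (outer_pole e r w)) \<le> Re (pole_majorant F \<rho> J w)"
    unfolding Re_pole_majorant r_def using \<open>j \<le> J\<close> nn
    by (intro member_le_sum[of j "{..J}" "\<lambda>j. 9 * 2 powr \<rho> * (2 powr \<rho>) ^ j * (1/2) ^ j * (\<Sum>e\<in>F j. Re (outer_pole e ((1/2) ^ j) w))"])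
       (auto intro!: mult_nonneg_nonneg sum_nonneg)
  finally have "(2 powr \<rho>) ^ Suc j \<le> Re (pole_majorant F \<rho> J w)" .
  moreover have "1 / d powr \<rho> \<le> 1 / ((1/2) ^ Suc j) powr \<rho>"
    using j \<rho> \<open>d > 0\<close> by (intro divide_left_mono powr_mono2 mult_pos_pos) auto
  moreover have "1 / ((1/2) ^ Suc j) powr \<rho> = (2 powr \<rho>) ^ Suc j"
    by (simp add: powr_realpow[symmetric] powr_powr powr_divide power_one_over mult.commute del: power_Suc)
  ultimately show ?thesis
    by (simp add: d_def)
qed

text \<open>At a fixed p each pole contributes at most 1/(1 - |p|), so scale j costs its weight
  times the size of the net, which is of order 2^(j (\<rho> - b)).\<close>

lemma pole_majorant_le:
  assumes F: "\<And>j. F j \<subseteq> sphere 0 1" and p: "cmod p < 1"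
    and card: "\<And>j. card (F j) * (1/2) ^ j \<le> M * ((1/2) ^ j) powr b"
  shows "Re (pole_majorant F \<rho> J p) \<le> 9 * 2 powr \<rho> * M / (1 - cmod p) * (\<Sum>j\<le>J. (2 powr (\<rho> - b)) ^ j)"
proof -
  have "9 * 2 powr \<rho> * (2 powr \<rho>) ^ j * (1/2) ^ j * (\<Sum>e\<in>F j. Re (outer_pole e ((1/2) ^ j) p))
      \<le> 9 * 2 powr \<rho> * M / (1 - cmod p) * (2 powr (\<rho> - b)) ^ j" for j
  proof -
  have "(\<Sum>e\<in>F j. Re (outer_pole e ((1/2) ^ j) p)) \<le> (\<Sum>e\<in>F j. 1 / (1 - cmod p))"
    using F[of j] p by (intro sum_mono Re_outer_pole_le) auto
  then have "9 * 2 powr \<rho> * (2 powr \<rho>) ^ j * (1/2) ^ j * (\<Sum>e\<in>F j. Re (outer_pole e ((1/2) ^ j) p))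
      \<le> 9 * 2 powr \<rho> * (2 powr \<rho>) ^ j * (1/2) ^ j * (card (F j) * (1 / (1 - cmod p)))"
    by (intro mult_left_mono) auto
  also have "\<dots> = 9 * 2 powr \<rho> * (2 powr \<rho>) ^ j / (1 - cmod p) * (card (F j) * (1/2) ^ j)"
    by simp
  also have "\<dots> \<le> 9 * 2 powr \<rho> * (2 powr \<rho>) ^ j / (1 - cmod p) * (M * ((1/2) ^ j) powr b)"
    using card p by (intro mult_left_mono) auto
  also have "((1/2) ^ j) powr b = (2 powr (- b)) ^ j"
    by (simp add: powr_power powr_realpow[symmetric] powr_minus powr_powr power_one_over powr_divide inverse_eq_divide mult.commute)
  also have "9 * 2 powr \<rho> * (2 powr \<rho>) ^ j / (1 - cmod p) * (M * (2 powr (- b)) ^ j)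
      = 9 * 2 powr \<rho> * M / (1 - cmod p) * (2 powr \<rho> * 2 powr (- b)) ^ j"
    by (simp add: power_mult_distrib)
  also have "2 powr \<rho> * 2 powr (- b) = 2 powr (\<rho> - b)"
    by (simp add: powr_add[symmetric])
  finally show ?thesis .
  qed
  then show ?thesis
    unfolding Re_pole_majorant sum_distrib_left[of "9 * 2 powr \<rho> * M / (1 - cmod p)"]
    by (rule sum_mono)
qed

subsection \<open>The local Blaschke condition\<close>

text \<open>With s = \<kappa>^2/8 the orthogonal circle has radius at most 3 \<kappa>/4, and its
  centre is at distance s < \<kappa>/4 from t.\<close>

lemma orth_lune_subset_ball:
  assumes t: "cmod t = 1" and \<kappa>: "0 < \<kappa>" "\<kappa> < 1"
  shows "orth_lune (of_real (1 + \<kappa>\<^sup>2 / 8) * t) \<subseteq> ball t \<kappa>"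
proof
  define s where "s = \<kappa>\<^sup>2 / 8"
  let ?c = "of_real (1 + s) * t"
  have s: "0 < s" "s < 1"
    using \<kappa> power_le_one[of \<kappa> 2] by (auto simp: s_def)
  have norm_c: "cmod ?c = 1 + s"
    using s t by (simp add: norm_mult del: of_real_add)
  fix w assume "w \<in> orth_lune (of_real (1 + \<kappa>\<^sup>2 / 8) * t)"
  then have "w \<in> ball ?c (sqrt ((1 + s)\<^sup>2 - 1))"
    using orth_lune_eq_balls[of ?c] s unfolding norm_c s_def[symmetric] by simp
  then have "dist ?c w < sqrt ((1 + s)\<^sup>2 - 1)"
    by simp
  also have "\<dots> \<le> 3/4 * \<kappa>"
  proof (rule real_le_lsqrt)
    have "(1 + s)\<^sup>2 - 1 = s * (2 + s)"
      by (simp add: power2_eq_square algebra_simps)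
    also have "\<dots> \<le> s * 3"
      using s by (intro mult_left_mono) auto
    also have "\<dots> \<le> (3/4 * \<kappa>)\<^sup>2"
      by (simp add: s_def power_mult_distrib power_divide)
    finally show "(1 + s)\<^sup>2 - 1 \<le> (3/4 * \<kappa>)\<^sup>2" .
  qed (use \<kappa> in auto)
  finally have "dist ?c w < 3/4 * \<kappa>" .
  moreover have "dist t ?c = s"
  proof -
    have "t - ?c = - (of_real s * t)"
      by (simp add: algebra_simps)
    then show ?thesis
      using s t by (simp add: dist_norm norm_mult)
  qed
  moreover have "s < \<kappa> / 4"
    using \<kappa> mult_strict_left_mono[of \<kappa> 1 \<kappa>] by (simp add: s_def power2_eq_square)
  ultimately show "w \<in> ball t \<kappa>"
    using dist_triangle[of t w ?c] by simp
qed

lemma orth_defect_near_center: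
  assumes t: "cmod t = 1" and s: "0 < s" "s < 1" and w: "dist t w < s / 3"
  shows "orth_defect (of_real (1 + s) * t) w \<le> - s"
proof -
  let ?c = "of_real (1 + s) * t"
  have norm_c: "cmod ?c = 1 + s"
    using s t by (simp add: norm_mult del: of_real_add)
  have "t - ?c = - (of_real s * t)"
    by (simp add: algebra_simps)
  then have "dist t ?c = s"
    using s t by (simp add: dist_norm norm_mult)
  then have "cmod (w - ?c) \<le> s + s / 3"
    using dist_triangle[of w ?c t] w by (simp add: dist_norm norm_minus_commute)
  then have "(cmod (w - ?c))\<^sup>2 \<le> (s + s / 3)\<^sup>2"
    by (intro power_mono) auto
  also have "\<dots> = s\<^sup>2 + 7/9 * (s * s)"
    by (simp add: power2_eq_square field_simps)
  also have "\<dots> \<le> s\<^sup>2 + s"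
    using s mult_left_mono[of s 1 s] by simp
  finally show ?thesis
    unfolding orth_defect_eq_power norm_c by (simp add: power2_eq_square algebra_simps)
qed

theorem theorem7:
  fixes E :: "complex set" and t :: complex and \<tau> \<epsilon> :: real
  assumes "closed E" and "E \<subseteq> sphere 0 1" and "t \<in> E"
    and "0 < \<tau>" and "\<tau> < 1" and "\<epsilon> > 0"
  shows "\<exists>\<delta>>0. \<delta> < \<tau> \<and>
    (\<forall>(\<rho>::real) (C::real) (f :: complex \<Rightarrow> complex).
       \<rho> > 0 \<longrightarrow> C > 0 \<longrightarrow>
       f analytic_on lune t \<tau> \<longrightarrow> (\<exists>z\<in>lune t \<tau>. f z \<noteq> 0) \<longrightarrow>
       (\<forall>z\<in>lune t \<tau>. f z \<noteq> 0 \<longrightarrow> ln (cmod (f z)) \<le> C / infdist z E powr \<rho>) \<longrightarrow>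
       (\<lambda>z. of_int (zorder f z) *
              ((1 - cmod z) * infdist z E powr max (\<rho> - local_type E t + \<epsilon>) 0))
         summable_on {z \<in> lune t \<delta>. f z = 0})"
proof -
  have t: "cmod t = 1" and "E \<noteq> {}"
    using assms by auto
  \<comment> \<open>The choices from here to \<open>s\<close> involve only E, t, \<tau> and
    \<epsilon>, so \<delta> is fixed before \<rho>, C and f. The exponent \<open>b\<close> holds for
    the part of E near t.\<close>
  obtain r b M where r: "0 < r" "r \<le> 1" and b: "local_type E t - \<epsilon> < b" and "M > 0"
    and M: "\<And>x. 0 < x \<Longrightarrow> x \<le> 1 \<Longrightarrow>
      measure circle_measure (arc_nbhd (E \<inter> cball t r) x) \<le> M * x powr b"
    using local_type_measure_bound[OF assms(2,3,6)] by blast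
  let ?E = "E \<inter> cball t r"
  have "t \<in> ?E"
    using assms r by simp
  have "\<exists>F. finite F \<and> F \<subseteq> ?E \<and> (\<forall>e\<in>?E. \<exists>y\<in>F. dist e y < (1/2) ^ j) \<and>
    card F * (1/2) ^ j \<le> 4 * pi * measure circle_measure (arc_nbhd ?E ((1/2) ^ j))" for j
    using assms \<open>t \<in> ?E\<close> by (intro exists_net) (auto simp: power_le_one)
  then obtain F where F: "\<And>j. finite (F j)" "\<And>j. F j \<subseteq> ?E"
    and net: "\<And>j e. e \<in> ?E \<Longrightarrow> \<exists>y\<in>F j. dist e y < (1/2) ^ j"
    and card: "\<And>j. card (F j) * (1/2) ^ j \<le> 4 * pi * measure circle_measure (arc_nbhd ?E ((1/2) ^ j))"
    by metis
  have F_sphere: "F j \<subseteq> sphere 0 1" for j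
    using F(2)[of j] assms(2) by blast
  have card': "card (F j) * (1/2) ^ j \<le> 4 * pi * M * ((1/2) ^ j) powr b" for j
  proof -
    note card[of j]
    also have "4 * pi * measure circle_measure (arc_nbhd ?E ((1/2) ^ j)) \<le> 4 * pi * (M * ((1/2) ^ j) powr b)"
      by (intro mult_left_mono M) (auto simp: power_le_one)
    finally show ?thesis
      by (simp only: mult.assoc)
  qed
  \<comment> \<open>The bound \<tau> keeps the orthogonal lune inside the domain of f. The bound r/3
    puts the point of E nearest to any z of the lune within 2 \<kappa> < r of t, so distances to E
    are realized in the local part.\<close>
  define \<kappa> where "\<kappa> = min \<tau> (r / 3)"
  have \<kappa>: "0 < \<kappa>" "\<kappa> < 1" "\<kappa> \<le> \<tau>" "\<kappa> \<le> r / 3"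
    using assms r by (auto simp: \<kappa>_def)
  define s where "s = \<kappa>\<^sup>2 / 8"
  have s: "0 < s" "s < 1" "s < \<tau>"
  proof -
    have "\<kappa>\<^sup>2 \<le> \<kappa>"
      using \<kappa> by (simp add: power2_eq_square mult_left_le)
    then show "s < 1" "s < \<tau>"
      using \<kappa> by (simp_all add: s_def)
  qed (use \<kappa> in \<open>simp add: s_def\<close>)
  define c where "c = of_real (1 + s) * t"
  have c: "1 < cmod c" "cmod c \<le> 2"
    using s t by (simp_all add: c_def norm_mult del: of_real_add)
  let ?G = "orth_lune c"
  have G_ball: "?G \<subseteq> ball t \<kappa>"
    unfolding c_def s_def by (rule orth_lune_subset_ball[OF t \<kappa>(1,2)])
  then have G_lune: "?G \<subseteq> lune t \<tau>"
    using \<kappa> by (auto simp: lune_def orth_lune_def)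
  \<comment> \<open>The radius s/3 will be \<delta>: on this smaller lune the defect is bounded away
    from 0, which makes the decay of the barriers uniform over all its zeros.\<close>
  have defect: "orth_defect c z \<le> - s" if "z \<in> lune t (s / 3)" for z
    unfolding c_def using that by (intro orth_defect_near_center t s) (auto simp: lune_def)
  then have small_lune: "lune t (s / 3) \<subseteq> ?G"
    using s by (force simp: orth_lune_def lune_def)
  have nearest: "\<exists>e\<in>?E. infdist z E = dist z e" and dist_le: "infdist z E \<le> 1" if z: "z \<in> ?G" for z
  proof -
    have zt: "dist t z < \<kappa>"
      using G_ball z by auto
    have "infdist z E \<le> dist z t"
      using \<open>t \<in> E\<close> by (rule infdist_le)
    then have le: "infdist z E < \<kappa>"
      using zt by (simp add: dist_commute)
    then show "infdist z E \<le> 1"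
      using \<kappa> by simp
    obtain e where e: "e \<in> E" "infdist z E = dist z e"
      using infdist_attains_inf[OF \<open>closed E\<close> \<open>E \<noteq> {}\<close>] by metis
    then have "dist t e \<le> r"
      using dist_triangle[of t e z] zt le \<kappa> by simp
    then show "\<exists>e\<in>?E. infdist z E = dist z e"
      using e by auto
  qed
  have pos: "infdist z E \<ge> 1 - cmod z" for z
    using one_minus_norm_le_infdist[OF assms(2) \<open>E \<noteq> {}\<close>] .
  show ?thesis
  proof (intro exI[of _ "s / 3"] conjI allI impI)
    show "s / 3 > 0" "s / 3 < \<tau>"
      using s by auto
    fix \<rho> C :: real and f :: "complex \<Rightarrow> complex"
    assume \<rho>: "\<rho> > 0" and C: "C > 0" and f: "f analytic_on lune t \<tau>" and nz: "\<exists>z\<in>lune t \<tau>. f z \<noteq> 0"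
      and growth: "\<forall>z\<in>lune t \<tau>. f z \<noteq> 0 \<longrightarrow> ln (cmod (f z)) \<le> C / infdist z E powr \<rho>"
    have hol: "f holomorphic_on lune t \<tau>"
      using f by (rule analytic_imp_holomorphic)
    then have holG: "f holomorphic_on ?G"
      using G_lune by (rule holomorphic_on_subset)
    have "of_real (1 - s / 6) * t \<in> lune t (s / 3)"
    proof -
      have "cmod (of_real (1 - s / 6) * t) = 1 - s / 6"
        using s t by (simp add: norm_mult del: of_real_diff)
      moreover have diff: "t - of_real (1 - s / 6) * t = of_real (s / 6) * t"
        by (simp add: algebra_simps)
      have "dist t (of_real (1 - s / 6) * t) = s / 6"
        unfolding dist_norm diff norm_mult norm_of_real t using s by simp
      ultimately show ?thesis
        using s by (simp add: lune_def del: of_real_diff)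
    qed
    then have "?G \<noteq> {}"
      using small_lune by blast
    \<comment> \<open>Otherwise the identity theorem would make f vanish on the whole original
      lune.\<close>
    have "\<exists>p\<in>?G. f p \<noteq> 0"
    proof (rule ccontr)
      assume "\<not> (\<exists>p\<in>?G. f p \<noteq> 0)"
      then have zero: "f p = 0" if "p \<in> ?G" for p
        using that by blast
      obtain p where p: "p \<in> ?G"
        using \<open>?G \<noteq> {}\<close> by blast
      have "open (lune t \<tau>)" "connected (lune t \<tau>)"
        by (auto simp: lune_def convex_Int intro: convex_connected)
      moreover have "p islimpt ?G"
        using p open_orth_lune[OF c(1)] by (simp add: interior_limit_point interior_open)
      ultimately have "f z = 0" if "z \<in> lune t \<tau>" for z
        using analytic_continuation[OF hol _ _ G_lune _ _ zero that] p G_lune by blast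
      then show False
        using nz by blast
    qed
    then obtain p where p: "p \<in> ?G" "f p \<noteq> 0"
      by blast
    then have p1: "cmod p < 1" "orth_defect c p < 0"
      by (auto simp: orth_lune_def)
    define \<mu> where "\<mu> = s * (- orth_defect c p) * (1 - (cmod p)\<^sup>2) / 288"
    have "\<mu> > 0"
    proof -
      have "1 - (cmod p)\<^sup>2 > 0" "- orth_defect c p > 0"
        using p1 by (auto simp: abs_square_less_1)
      then show ?thesis
        unfolding \<mu>_def using s by (intro divide_pos_pos mult_pos_pos) auto
    qed
    \<comment> \<open>Three demands on \<eta>: the barriers need 1/32, the pole term may use only
      half of the decay \<mu>, and p must satisfy d(p,E) > \<eta> x at every scale x \<le>
      1.\<close>
    define B where "B = min (1/32) (min (\<mu> * (1 - cmod p) / 200) (infdist p E))"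
    have "B > 0"
      using \<open>\<mu> > 0\<close> p1 pos[of p] by (auto simp: B_def)
    then obtain m where m: "(1/2) ^ m < B"
      using real_arch_pow_inv[of B "1/2"] by auto
    \<comment> \<open>A power of 1/2, so that \<eta> * 2^-k is the dyadic cutoff 2^-(k + m) of the
      majorant.\<close>
    define \<eta> :: real where "\<eta> = (1/2) ^ m"
    have \<eta>: "0 < \<eta>" "\<eta> \<le> 1/32" "\<eta> < infdist p E"
      using m by (auto simp: B_def \<eta>_def)
    have \<eta>\<mu>: "100 * \<eta> / (1 - cmod p) \<le> \<mu> / 2"
      using m p1 by (simp add: B_def \<eta>_def field_simps)
    define D where "D = C * (9 * 2 powr \<rho> * (4 * pi * M) / (1 - cmod p))"
    have "D \<ge> 0"
      using C \<open>M > 0\<close> p1 by (simp add: D_def)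
    let ?Z = "{z \<in> lune t (s / 3). f z = 0}"
    have ord: "zorder f z \<ge> 0" if "z \<in> ?Z" for z
      using that p small_lune
      by (intro zorder_nonneg[OF holG open_orth_lune[OF c(1)] connected_orth_lune[OF c(1)]]) auto
    have "(\<lambda>z. (of_int (zorder f z) * (1 - cmod z)) * infdist z E powr max (\<rho> - local_type E t + \<epsilon>) 0)
        summable_on ?Z"
    proof (rule dyadic_growth_imp_weighted_summable[where s = "\<rho> - b" and M = m and C = "2 / \<mu> * (D + \<bar>ln (cmod (f p))\<bar>)"])
      \<comment> \<open>The strict inequality comes from b > \<beta>(t) - \<epsilon>; this is where
        the loss of \<epsilon> is spent.\<close>
      show "0 \<le> max (\<rho> - local_type E t + \<epsilon>) 0" "\<rho> - b < max (\<rho> - local_type E t + \<epsilon>) 0"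
        using b by auto
      show "0 \<le> 2 / \<mu> * (D + \<bar>ln (cmod (f p))\<bar>)"
        using \<open>D \<ge> 0\<close> \<open>\<mu> > 0\<close> by simp
      show "0 \<le> of_int (zorder f z) * (1 - cmod z) \<and> 0 < infdist z E \<and> infdist z E \<le> 1" if "z \<in> ?Z" for z
      proof -
        have "cmod z < 1" "z \<in> ?G"
          using that small_lune by (auto simp: lune_def)
        then show ?thesis
          using ord[OF that] pos[of z] dist_le[of z] by auto
      qed
      fix A k assume A: "finite A" "A \<subseteq> ?Z" "\<And>a. a \<in> A \<Longrightarrow> (1/2) ^ k \<le> infdist a E"
      let ?K = "\<lambda>w. of_real C * pole_majorant F \<rho> (k + m) w"
      let ?S = "\<Sum>j\<le>k + m. (2 powr (\<rho> - b)) ^ j"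
      have \<eta>x: "\<eta> * (1/2) ^ k = (1/2) ^ (k + m)" "\<eta> * (1/2) ^ k \<le> \<eta>"
        using \<eta> by (auto simp: \<eta>_def power_add mult_left_le power_le_one)
      have fK: "cmod (f w) \<le> exp (Re (?K w))" if w: "w \<in> ?G" "infdist w E > \<eta> * (1/2) ^ k" for w
      proof (cases "f w = 0")
        case False
        obtain e where e: "e \<in> ?E" "infdist w E = dist w e"
          using nearest[OF w(1)] by blast
        have "1 / dist w e powr \<rho> \<le> Re (pole_majorant F \<rho> (k + m) w)"
          using w e \<eta>x dist_le[OF w(1)] \<rho>
          by (intro pole_majorant_ge F F_sphere net) (auto simp: orth_lune_def)
        then have "C * (1 / infdist w E powr \<rho>) \<le> C * Re (pole_majorant F \<rho> (k + m) w)"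
          unfolding e(2) using C by (intro mult_left_mono) auto
        then have "ln (cmod (f w)) \<le> Re (?K w)"
          using growth G_lune w(1) False by force
        then show ?thesis
          using False by (simp add: ln_le_cancel_iff[symmetric] del: ln_le_cancel_iff)
      qed simp
      have "\<mu> / 2 * (\<Sum>a\<in>A. of_int (zorder f a) * (1 - cmod a)) \<le> Re (?K p) - ln (cmod (f p))"
      proof (rule zero_sum_bound[OF c assms(2) \<open>E \<noteq> {}\<close> holG p _ fK \<open>finite A\<close> _ _ s(1) _ \<eta>(1,2) _ \<mu>_def \<eta>\<mu>])
        show "?K holomorphic_on ?G"
          by (intro holomorphic_intros holomorphic_on_subset[OF holomorphic_pole_majorant[OF F_sphere]])
             (auto simp: orth_lune_def)
        show "A \<subseteq> ?G"
          using A(2) small_lune by auto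
        show "orth_defect c a \<le> - s \<and> (1/2) ^ k \<le> infdist a E" if "a \<in> A" for a
          using A(2,3) that defect by auto
        show "\<eta> * (1/2) ^ k < infdist p E"
          using \<eta>x \<eta> by linarith
      qed auto
      also have "\<dots> \<le> D * ?S + \<bar>ln (cmod (f p))\<bar>"
      proof -
        have "C * Re (pole_majorant F \<rho> (k + m) p) \<le> C * (9 * 2 powr \<rho> * (4 * pi * M) / (1 - cmod p) * ?S)"
          using C p1 card' by (intro mult_left_mono pole_majorant_le F_sphere) auto
        then show ?thesis
          by (simp add: D_def mult.assoc)
      qed
      also have "\<dots> \<le> (D + \<bar>ln (cmod (f p))\<bar>) * (1 + ?S)"
        using \<open>D \<ge> 0\<close> by (simp add: algebra_simps sum_nonneg)
      finally show "(\<Sum>a\<in>A. of_int (zorder f a) * (1 - cmod a)) \<le> 2 / \<mu> * (D + \<bar>ln (cmod (f p))\<bar>) * (1 + ?S)"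
        using \<open>\<mu> > 0\<close> by (simp add: field_simps)
    qed
    then show "(\<lambda>z. of_int (zorder f z) * ((1 - cmod z) * infdist z E powr max (\<rho> - local_type E t + \<epsilon>) 0))
        summable_on ?Z"
      by (simp only: mult.assoc)
  qed
qed

end
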